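(* The space $(\mathbb R^3,d_{CC})$ is ideal in the following sense. (1) There are no abnormal length minimizers: no constant-speed length minimizer $\gamma:[0,T]\to\mathbb R^3$ admits an absolutely continuous covector lift $\lambda(t)$, not identically zero, with $H_f(\gamma(t),\lambda(t))=0$ for all $t\in[0,T]$. (2) Every nonconstant normal trajectory is a geodesic.
   Context: Let $\mathfrak F$ be the set of $f\in C^0[0,\infty)$ satisfying the following: (i) $f(r)>0$ for $r>0$ and $f(0)=0$; (ii) $f|_{(0,\infty)}\in C^2(0,\infty)$; (iii) $f(r)\dot f(r)/r$ extends continuously to $r=0$; (iv) $f$ is strictly increasing and $f(r)\to+\infty$ as $r\to+\infty$; (v) $f(r)^2/\dot f(r)\to+\infty$ as $r\to+\infty$. Fix $f\in\mathfrak F$. On $\mathbb R^3$ write points as $q=(x,y,z)$ and set $r=\sqrt{x^2+y^2}$. Let $X=\partial_x$, $Y=\partial_y$, $Z_f=f(r)\partial_z$, and let $\Sigma=\{r=0\}$. Admissible curves, length and $d_{CC}$: - An absolutely continuous $\gamma:[0,T]\to\mathbb R^3$ is admissible if $\gamma'=u_1X+u_2Y+u_3Z_f$ a.e. for some $u\in L^2([0,T];\mathbb R^3)$. - Its length is $\ell(\gamma)=\int_0^T\sqrt{\dot x^2+\dot y^2+\dot z^2/f(r)^2}\,dt$. - $d_{CC}(q,q')$ is the infimum of $\ell(\gamma)$ over admissible curves from $q$ to $q'$. Minimizers and geodesics: - An admissible $\gamma$ is a length minimizer if $\ell(\gamma)\le\ell(\tilde\gamma)$ for every admissible $\tilde\gamma$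 with the same endpoints. - $\gamma$ is a geodesic if for every $t\in[0,T)$ there is $\varepsilon>0$ such that $\gamma|_{[t,t+\varepsilon]}$ is a length minimizer parametrized with constant speed. Hamiltonian and normal trajectories: - The Hamiltonian is $H_f(q,\lambda)=\tfrac12(u^2+v^2+f(r)^2w^2)$ on $T^*\mathbb R^3\cong\mathbb R^3\times\mathbb R^3$, with $\lambda=(u,v,w)$. - Normal trajectories are the projections $\gamma=(x,y,z)$ of solutions of Hamilton's equations $$\dot x=u,\quad \dot y=v,\quad \dot z=f(r)^2w,\quad \dot u=-w^2f(r)\dot f(r)\,x/r,\quad \dot v=-w^2f(r)\dot f(r)\,y/r,\quad \dot w=0.$$
   Formalization: Part (1) is stated for nonconstant length minimizers: a constant curve at a point of Σ is a minimizer of speed 0 and admits the nonzero lift λ = (0,0,1) with H_f = 0, so the claim fails for it. *)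

theory Defs
  imports "HOL-Analysis.Analysis"
begin

type_synonym pt = "real \<times> real \<times> real"

definition rad :: "pt \<Rightarrow> real" where
  "rad q = sqrt ((fst q)\<^sup>2 + (fst (snd q))\<^sup>2)"

definition classF :: "(real \<Rightarrow> real) \<Rightarrow> bool" where
  "classF f \<longleftrightarrow>
     continuous_on {0..} f \<and>
     f 0 = 0 \<and> (\<forall>r>0. f r > 0) \<and>
     (\<exists>f' f''. (\<forall>r>0. (f has_real_derivative f' r) (at r)) \<and>
               (\<forall>r>0. (f' has_real_derivative f'' r) (at r)) \<and>
               continuous_on {0<..} f'') \<and>
     (\<exists>L. ((\<lambda>r. f r * deriv f r / r) \<longlongrightarrow> L) (at_right 0)) \<and>
     strict_mono_on {0..} f \<and> filterlim f at_top at_top \<and>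
     filterlim (\<lambda>r. (f r)\<^sup>2 / deriv f r) at_top at_top"

definition abs_cont_on :: "real set \<Rightarrow> (real \<Rightarrow> 'a::real_normed_vector) \<Rightarrow> bool" where
  "abs_cont_on S g \<longleftrightarrow>
     (\<forall>\<epsilon>>0. \<exists>\<delta>>0. \<forall>(n::nat) (a::nat \<Rightarrow> real) b.
        (\<forall>i<n. a i \<le> b i \<and> {a i..b i} \<subseteq> S) \<and>
        disjoint_family_on (\<lambda>i. {a i<..<b i}) {..<n} \<and>
        (\<Sum>i<n. b i - a i) < \<delta> \<longrightarrow>
        (\<Sum>i<n. norm (g (b i) - g (a i))) < \<epsilon>)"

text \<open>Admissible curve gamma : [0,T] -> R^3: absolutely continuous and
  gamma' = u1 X + u2 Y + u3 Z_f a.e. with u in L^2([0,T]; R^3).\<close>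
definition admissible :: "(real \<Rightarrow> real) \<Rightarrow> real \<Rightarrow> (real \<Rightarrow> pt) \<Rightarrow> bool" where
  "admissible f T \<gamma> \<longleftrightarrow> 0 \<le> T \<and> abs_cont_on {0..T} \<gamma> \<and>
     (\<exists>u1 u2 u3 :: real \<Rightarrow> real.
        u1 measurable_on {0..T} \<and> u2 measurable_on {0..T} \<and> u3 measurable_on {0..T} \<and>
        (\<lambda>t. (u1 t)\<^sup>2) integrable_on {0..T} \<and> (\<lambda>t. (u2 t)\<^sup>2) integrable_on {0..T} \<and>
        (\<lambda>t. (u3 t)\<^sup>2) integrable_on {0..T} \<and>
        (\<exists>N. negligible N \<and> (\<forall>t\<in>{0..T} - N.
           (\<gamma> has_vector_derivative (u1 t, u2 t, u3 t * f (rad (\<gamma> t)))) (at t within {0..T}))))"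

definition speed :: "(real \<Rightarrow> real) \<Rightarrow> real \<Rightarrow> (real \<Rightarrow> pt) \<Rightarrow> real \<Rightarrow> real" where
  "speed f T \<gamma> t = (let d = vector_derivative \<gamma> (at t within {0..T}) in
      sqrt ((fst d)\<^sup>2 + (fst (snd d))\<^sup>2 + (snd (snd d))\<^sup>2 / (f (rad (\<gamma> t)))\<^sup>2))"

definition len :: "(real \<Rightarrow> real) \<Rightarrow> real \<Rightarrow> (real \<Rightarrow> pt) \<Rightarrow> real" where
  "len f T \<gamma> = integral {0..T} (speed f T \<gamma>)"

definition length_minimizer :: "(real \<Rightarrow> real) \<Rightarrow> real \<Rightarrow> (real \<Rightarrow> pt) \<Rightarrow> bool" where
  "length_minimizer f T \<gamma> \<longleftrightarrow> admissible f T \<gamma> \<and>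
     (\<forall>T' \<gamma>'. admissible f T' \<gamma>' \<and> \<gamma>' 0 = \<gamma> 0 \<and> \<gamma>' T' = \<gamma> T \<longrightarrow>
        len f T \<gamma> \<le> len f T' \<gamma>')"

definition const_speed :: "(real \<Rightarrow> real) \<Rightarrow> real \<Rightarrow> (real \<Rightarrow> pt) \<Rightarrow> bool" where
  "const_speed f T \<gamma> \<longleftrightarrow>
     (\<exists>c N. negligible N \<and> (\<forall>t\<in>{0..T} - N. speed f T \<gamma> t = c))"

definition geodesic :: "(real \<Rightarrow> real) \<Rightarrow> real \<Rightarrow> (real \<Rightarrow> pt) \<Rightarrow> bool" where
  "geodesic f T \<gamma> \<longleftrightarrow>
     (\<forall>t\<in>{0..<T}. \<exists>\<epsilon>>0. t + \<epsilon> \<le> T \<and>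
        length_minimizer f \<epsilon> (\<lambda>s. \<gamma> (t + s)) \<and> const_speed f \<epsilon> (\<lambda>s. \<gamma> (t + s)))"

definition ham :: "(real \<Rightarrow> real) \<Rightarrow> pt \<Rightarrow> pt \<Rightarrow> real" where
  "ham f q l = ((fst l)\<^sup>2 + (fst (snd l))\<^sup>2 + (f (rad q))\<^sup>2 * (snd (snd l))\<^sup>2) / 2"

text \<open>(x,y,z,u,v,w) solves Hamilton's equations on [0,T].  At r = 0 the terms
  x/r, y/r evaluate to 0 (Isabelle division by 0), consistent with the continuous
  extension of f f'/r times x -> 0.\<close>
definition hamilton_sol :: "(real \<Rightarrow> real) \<Rightarrow> real \<Rightarrow>
   (real \<Rightarrow> real) \<Rightarrow> (real \<Rightarrow> real) \<Rightarrow> (real \<Rightarrow> real) \<Rightarrow>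
   (real \<Rightarrow> real) \<Rightarrow> (real \<Rightarrow> real) \<Rightarrow> (real \<Rightarrow> real) \<Rightarrow> bool" where
  "hamilton_sol f T x y z u v w \<longleftrightarrow>
     (\<forall>t\<in>{0..T}. let r = sqrt ((x t)\<^sup>2 + (y t)\<^sup>2) in
        (x has_real_derivative u t) (at t within {0..T}) \<and>
        (y has_real_derivative v t) (at t within {0..T}) \<and>
        (z has_real_derivative (f r)\<^sup>2 * w t) (at t within {0..T}) \<and>
        (u has_real_derivative - (w t)\<^sup>2 * f r * deriv f r * x t / r) (at t within {0..T}) \<and>
        (v has_real_derivative - (w t)\<^sup>2 * f r * deriv f r * y t / r) (at t within {0..T}) \<and>
        (w has_real_derivative 0) (at t within {0..T}))"

definition normal_trajectory :: "(real \<Rightarrow> real) \<Rightarrow> real \<Rightarrow> (real \<Rightarrow> pt) \<Rightarrow> bool" where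
  "normal_trajectory f T \<gamma> \<longleftrightarrow>
     (\<exists>x y z u v w. hamilton_sol f T x y z u v w \<and>
        (\<forall>t\<in>{0..T}. \<gamma> t = (x t, y t, z t)))"

end

theory Submission
  imports Defs
begin

text \<open>
  Along an abnormal lift the covector is \<open>(0, 0, w)\<close> with \<open>f w = 0\<close>, so on an interval where \<open>w \<noteq> 0\<close> the
  curve stays on the axis, where no nonzero admissible velocity is tangent to the axis. Constant speed makes the
  whole curve constant.

  A normal trajectory conserves \<open>w\<close> and \<open>u\<^sup>2 + v\<^sup>2 + f\<^sup>2 w\<^sup>2 = c\<^sup>2\<close>. If it starts on the axis it is radial, and
  \<open>P(r) + w z\<close> with \<open>P' = (c\<^sup>2 - w\<^sup>2 f\<^sup>2)\<^sup>1\<^sup>/\<^sup>2\<close> calibrates it. If it starts off the axis, its planar part is an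
  extremal of the action with potential \<open>V = w\<^sup>2 f\<^sup>2 / 2\<close>, because \<open>dz\<^sup>2 / (2 f\<^sup>2) \<ge> w dz - V\<close> with equality on
  the trajectory. As \<open>V\<close> is semiconcave away from the axis, \<open>V(q + h) \<le> V(q) + \<nabla>V(q) h + K |h|\<^sup>2 / 2\<close>, and on
  short time intervals the kinetic energy of \<open>h\<close> dominates \<open>K |h|\<^sup>2\<close>, so the extremal minimizes the action.
  Lengths are compared with actions by running the trajectory along a clock that advances slightly
  faster than the arc length of the competitor.
\<close>

section \<open>Absolutely continuous functions\<close>

text \<open>Condition (iii) controls \<open>f f' / r\<close> near the axis, but nothing there
  controls the second derivative of \<open>f\<^sup>2\<close>, so the semiconcavity constant may blow
  up. This is why the two starting positions need different arguments and why the off-axis one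
  confines all curves to an annulus. On the axis an explicit radial solution of the eikonal equation
  calibrates. Off the axis an exact calibration would require a field of extremals; instead the
  first-order expansion of the value function along the single given trajectory is used, with a
  quadratic correction whose derivative pays for the error. Action depends on the parametrization
  and length does not. A competitor may stand still for a while, so its arc length need not be
  invertible; hence the trajectory is reparametrized and the competitor is left as it is. A
  competitor assumed strictly shorter leaves a gap, which pays both for a clock rate bounded away
  from 0 and for its continuity. Derivatives of competitors exist only almost everywhere, so every
  comparison is integrated by a fundamental theorem for absolutely continuous functions.\<close>

lemma abs_cont_onE:
  assumes "abs_cont_on S g" "\<epsilon> > 0"
  obtains \<delta> where "\<delta> > 0"
    "\<And>(I::'i set) a b. \<lbrakk>finite I; \<And>i. i \<in> I \<Longrightarrow> a i \<le> b i \<and> {a i..b i} \<subseteq> S;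
        disjoint_family_on (\<lambda>i. {a i<..<b i}) I; (\<Sum>i\<in>I. b i - a i) < \<delta>\<rbrakk>
      \<Longrightarrow> (\<Sum>i\<in>I. norm (g (b i) - g (a i))) < \<epsilon>"
proof -
  obtain \<delta> where "\<delta> > 0" and \<delta>: "\<And>(n::nat) a b. (\<forall>i<n. a i \<le> b i \<and> {a i..b i} \<subseteq> S) \<and>
        disjoint_family_on (\<lambda>i. {a i<..<b i}) {..<n} \<and> (\<Sum>i<n. b i - a i) < \<delta> \<Longrightarrow>
        (\<Sum>i<n. norm (g (b i) - g (a i))) < \<epsilon>"
    using assms unfolding abs_cont_on_def by meson
  show thesis
  proof (rule that[OF \<open>\<delta> > 0\<close>])
    fix I :: "'i set" and a b
    assume I: "finite I" "\<And>i. i \<in> I \<Longrightarrow> a i \<le> b i \<and> {a i..b i} \<subseteq> S"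
      "disjoint_family_on (\<lambda>i. {a i<..<b i}) I" "(\<Sum>i\<in>I. b i - a i) < \<delta>"
    obtain h where h: "bij_betw h {..<card I} I"
      using I(1) ex_bij_betw_nat_finite lessThan_atLeast0 by metis
    have hI: "h i \<in> I" if "i < card I" for i
      using h that by (auto simp: bij_betw_def)
    have dis: "disjoint_family_on (\<lambda>i. {a (h i)<..<b (h i)}) {..<card I}"
      unfolding disjoint_family_on_def
    proof (intro ballI impI)
      fix m n assume mn: "m \<in> {..<card I}" "n \<in> {..<card I}" "m \<noteq> n"
      then have "h m \<noteq> h n"
        using h by (auto simp: bij_betw_def inj_on_def)
      then show "{a (h m)<..<b (h m)} \<inter> {a (h n)<..<b (h n)} = {}"
        using I(3) hI mn unfolding disjoint_family_on_def by simp
    qed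
    have sums: "(\<Sum>i<card I. k (h i)) = (\<Sum>i\<in>I. k i)" for k :: "'i \<Rightarrow> real"
      by (rule sum.reindex_bij_betw[OF h])
    have "(\<Sum>i<card I. norm (g (b (h i)) - g (a (h i)))) < \<epsilon>"
      by (rule \<delta>) (use I hI dis sums[of "\<lambda>i. b i - a i"] in auto)
    then show "(\<Sum>i\<in>I. norm (g (b i) - g (a i))) < \<epsilon>"
      using sums[of "\<lambda>i. norm (g (b i) - g (a i))"] by simp
  qed
qed

text \<open>Outer regularity; the open set is what the gauge will assign to tags in the null
  set.\<close>

lemma negligible_outer_open:
  assumes "negligible N" "\<delta> > 0"
  obtains U where "open U" "N \<subseteq> U" "U \<in> lmeasurable" "measure lebesgue U < \<delta>"
proof -
  obtain U where U: "open U" "N \<subseteq> U" "U - N \<in> lmeasurable" "emeasure lebesgue (U - N) < ennreal \<delta>"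
    using sets_lebesgue_outer_open[of N \<delta>] assms negligible_imp_sets by blast
  have N: "N \<in> null_sets lebesgue"
    using assms negligible_iff_null_sets by blast
  have "U \<in> lmeasurable"
    using U(1,3) N by (metis borel_open measurable_Diff_null_set sets_completionI_sets sets_lborel)
  moreover have "measure lebesgue U = measure lebesgue (U - N)"
    using \<open>U \<in> lmeasurable\<close> N by (simp add: measure_Diff_null_set fmeasurableD)
  moreover have "measure lebesgue (U - N) < \<delta>"
    using U(3,4) by (simp add: emeasure_eq_measure2 ennreal_less_iff)
  ultimately show thesis
    using that U by simp
qed

text \<open>Tags in the null set are controlled by absolute continuity, because a fine gauge
  puts their intervals into an open set of small measure.\<close>

lemma has_integral_abs_cont:
  fixes g :: "real \<Rightarrow> 'a::banach"
  assumes ab: "a \<le> b" and ac: "abs_cont_on {a..b} g" and N: "negligible N"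
    and der: "\<And>t. t \<in> {a..b} - N \<Longrightarrow> (g has_vector_derivative g' t) (at t within {a..b})"
  shows "(g' has_integral g b - g a) {a..b}"
proof -
  \<comment> \<open>The integral does not see values on \<open>N\<close>. With value 0 there, a tag
    in \<open>N\<close> contributes only the increment of \<open>g\<close> over its
    interval.\<close>
  define G where "G t = (if t \<in> N then 0 else g' t)" for t
  have "(G has_integral g b - g a) {a..b}"
    unfolding has_integral box_real(2)[symmetric]
  proof (intro allI impI)
    fix e :: real assume "e > 0"
    \<comment> \<open>Each kind of tag gets half of \<open>e\<close>; the summand 1 keeps the
      denominator positive when \<open>a = b\<close>.\<close>
    define e1 where "e1 = e / (2 * (b - a + 1))"
    have "e1 > 0" using \<open>e > 0\<close> ab by (simp add: e1_def)
    have e1: "e1 * (b - a) < e / 2"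
      using \<open>e > 0\<close> ab by (simp add: e1_def field_simps)
    have "\<forall>x. \<exists>d>0. x \<in> {a..b} - N \<longrightarrow>
         (\<forall>y\<in>{a..b}. norm (y-x) < d \<longrightarrow> norm (g y - g x - (y-x) *\<^sub>R g' x) \<le> e1 * norm (y-x))"
      using der[unfolded has_vector_derivative_def has_derivative_within_alt] \<open>e1 > 0\<close>
      by (metis zero_less_one)
    then obtain d where d: "\<And>x. 0 < d x"
      "\<And>x y. \<lbrakk>x \<in> {a..b} - N; y \<in> {a..b}; norm (y-x) < d x\<rbrakk>
                        \<Longrightarrow> norm (g y - g x - (y-x) *\<^sub>R g' x) \<le> e1 * norm (y-x)"
      by metis
    have "e / 2 > 0" using \<open>e > 0\<close> by simp
    \<comment> \<open>The tagged intervals themselves will be the indices.\<close>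
    from abs_cont_onE[OF ac this, where 'i = "real \<times> real set"]
    obtain \<delta> where "\<delta> > 0" and \<delta>:
      "\<And>(I::(real \<times> real set) set) a' b'. \<lbrakk>finite I; \<And>i. i \<in> I \<Longrightarrow> a' i \<le> b' i \<and> {a' i..b' i} \<subseteq> {a..b};
        disjoint_family_on (\<lambda>i. {a' i<..<b' i}) I; (\<Sum>i\<in>I. b' i - a' i) < \<delta>\<rbrakk>
      \<Longrightarrow> (\<Sum>i\<in>I. norm (g (b' i) - g (a' i))) < e / 2" by blast
    obtain U where U: "open U" "N \<subseteq> U" "U \<in> lmeasurable" "measure lebesgue U < \<delta>"
      using negligible_outer_open[OF N \<open>\<delta> > 0\<close>] by blast
    define D where "D x = (if x \<in> N then U else ball x (d x))" for x
    have "gauge D"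
      unfolding gauge_def D_def using U d(1) by auto
    moreover have "norm ((\<Sum>(x, k)\<in>p. measure lborel k *\<^sub>R G x) - (g b - g a)) < e"
      if p: "p tagged_division_of (cbox a b)" and fine: "D fine p" for p
    proof -
      have fin: "finite p" by (rule tagged_division_of_finite[OF p])
      define q where "q = {z \<in> p. fst z \<in> N}"
      have K: "\<exists>u v. K = {u..v} \<and> u \<le> v \<and> x \<in> {u..v} \<and> {u..v} \<subseteq> {a..b} \<and> {u..v} \<subseteq> D x"
        if xK: "(x, K) \<in> p" for x K
      proof -
        obtain u v where uv: "K = {u..v}" using tagged_division_ofD(4)[OF p xK] by (auto simp: box_real)
        have "x \<in> {u..v}" "{u..v} \<subseteq> {a..b}"
          using tagged_division_ofD(2,3)[OF p xK] unfolding uv box_real .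
        moreover have "{u..v} \<subseteq> D x" using fineD[OF fine xK] uv by simp
        moreover have "u \<le> v" using calculation(1) by simp
        ultimately show ?thesis using uv by (intro exI[of _ u] exI[of _ v]) simp
      qed
      \<comment> \<open>The tag lies between the endpoints, so the two linearization errors at
        \<open>u\<close> and \<open>v\<close> add up to \<open>e1 * (v - u)\<close>.\<close>
      have bound: "norm (measure lborel K *\<^sub>R G x - (g (Sup K) - g (Inf K))) \<le> e1 * (Sup K - Inf K)"
        if xK: "(x, K) \<in> p" and "x \<notin> N" for x K
      proof -
        obtain u v where k: "K = {u..v}" "u \<le> v" "x \<in> {u..v}" "{u..v} \<subseteq> {a..b}" "{u..v} \<subseteq> D x"
          using K[OF xK] by blast
        have uv: "u \<in> D x" "v \<in> D x" "u \<in> {a..b}" "v \<in> {a..b}" "x \<in> {a..b} - N" using k \<open>x \<notin> N\<close> by auto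
        have "norm (u - x) < d x" "norm (v - x) < d x"
          using uv \<open>x \<notin> N\<close> by (auto simp: D_def dist_real_def)
        then have "norm (g u - g x - (u - x) *\<^sub>R g' x) \<le> e1 * norm (u - x)"
            "norm (g v - g x - (v - x) *\<^sub>R g' x) \<le> e1 * norm (v - x)"
          using d(2) uv by auto
        moreover have "norm ((v - u) *\<^sub>R g' x - (g v - g u)) \<le>
          norm (g u - g x - (u - x) *\<^sub>R g' x) + norm (g v - g x - (v - x) *\<^sub>R g' x)"
        proof -
          have "norm ((v - u) *\<^sub>R g' x - (g v - g u))
              = norm (g u - g x - (u - x) *\<^sub>R g' x - (g v - g x - (v - x) *\<^sub>R g' x))"
            by (simp add: algebra_simps)
          then show ?thesis using norm_triangle_ineq4 by metis
        qed
        ultimately have "norm ((v - u) *\<^sub>R g' x - (g v - g u)) \<le> e1 * norm (u - x) + e1 * norm (v - x)"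
          by linarith
        also have "\<dots> = e1 * (v - u)"
          using k by (simp add: algebra_simps)
        finally show ?thesis
          using k \<open>x \<notin> N\<close> by (simp add: G_def)
      qed
      have *: "(\<Sum>z\<in>p. measure lborel (snd z) *\<^sub>R G (fst z)) - (g b - g a)
          = (\<Sum>z\<in>p - q. measure lborel (snd z) *\<^sub>R G (fst z) - (g (Sup (snd z)) - g (Inf (snd z))))
            + (\<Sum>z\<in>q. - (g (Sup (snd z)) - g (Inf (snd z))))"
      proof -
        have "g b - g a = (\<Sum>z\<in>p. g (Sup (snd z)) - g (Inf (snd z)))"
          using additive_tagged_division_1[OF ab, of p g] p by (simp add: case_prod_beta)
        then have "(\<Sum>z\<in>p. measure lborel (snd z) *\<^sub>R G (fst z)) - (g b - g a)
          = (\<Sum>z\<in>p. measure lborel (snd z) *\<^sub>R G (fst z) - (g (Sup (snd z)) - g (Inf (snd z))))"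
          by (simp add: sum_subtractf)
        also have "\<dots> = (\<Sum>z\<in>p - q. measure lborel (snd z) *\<^sub>R G (fst z) - (g (Sup (snd z)) - g (Inf (snd z))))
            + (\<Sum>z\<in>q. measure lborel (snd z) *\<^sub>R G (fst z) - (g (Sup (snd z)) - g (Inf (snd z))))"
          using fin by (intro sum.subset_diff) (auto simp: q_def)
        also have "(\<Sum>z\<in>q. measure lborel (snd z) *\<^sub>R G (fst z) - (g (Sup (snd z)) - g (Inf (snd z))))
            = (\<Sum>z\<in>q. - (g (Sup (snd z)) - g (Inf (snd z))))"
          by (intro sum.cong) (auto simp: q_def G_def)
        finally show ?thesis .
      qed
      have "norm (\<Sum>z\<in>p - q. measure lborel (snd z) *\<^sub>R G (fst z) - (g (Sup (snd z)) - g (Inf (snd z))))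
          \<le> (\<Sum>z\<in>p - q. e1 * (Sup (snd z) - Inf (snd z)))"
        by (intro sum_norm_le) (use bound in \<open>auto simp: q_def\<close>)
      also have "\<dots> \<le> (\<Sum>z\<in>p. e1 * (Sup (snd z) - Inf (snd z)))"
        using fin K \<open>e1 > 0\<close> by (intro sum_mono2) (fastforce simp: q_def)+
      also have "\<dots> = e1 * (b - a)"
        using additive_tagged_division_1[OF ab, of p "\<lambda>x. x"] p
        by (simp add: case_prod_beta flip: sum_distrib_left)
      finally have 1: "norm (\<Sum>z\<in>p - q. measure lborel (snd z) *\<^sub>R G (fst z) - (g (Sup (snd z)) - g (Inf (snd z)))) < e / 2"
        using e1 by linarith
      have finq: "finite q" using fin by (simp add: q_def)
      have Kq: "Inf (snd z) \<le> Sup (snd z) \<and> {Inf (snd z)..Sup (snd z)} \<subseteq> {a..b} \<and> {Inf (snd z)<..<Sup (snd z)} \<subseteq> U"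
        if zq: "z \<in> q" for z
      proof -
        obtain x L where z: "z = (x, L)" by (cases z)
        have "x \<in> N" "(x, L) \<in> p" using zq z by (auto simp: q_def)
        from K[OF this(2)] obtain u v where "L = {u..v}" "u \<le> v" "{u..v} \<subseteq> {a..b}" "{u..v} \<subseteq> U"
          using \<open>x \<in> N\<close> by (auto simp: D_def)
        then show ?thesis using z by auto
      qed
      have dis: "disjoint_family_on (\<lambda>z. {Inf (snd z)<..<Sup (snd z)}) q"
        unfolding disjoint_family_on_def
      proof (intro ballI impI)
        fix z1 z2 assume z: "z1 \<in> q" "z2 \<in> q" "z1 \<noteq> z2"
        have "interior (snd z1) \<inter> interior (snd z2) = {}"
          using p z tagged_division_ofD(5)[OF p, of "fst z1" "snd z1" "fst z2" "snd z2"] by (auto simp: q_def)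
        moreover have "{Inf (snd z)<..<Sup (snd z)} = interior (snd z)" if zq: "z \<in> q" for z
        proof -
          obtain x L where z: "z = (x, L)" by (cases z)
          with zq have "(x, L) \<in> p" by (auto simp: q_def)
          from K[OF this] z show ?thesis by auto
        qed
        ultimately show "{Inf (snd z1)<..<Sup (snd z1)} \<inter> {Inf (snd z2)<..<Sup (snd z2)} = {}"
          using z by simp
      qed
      \<comment> \<open>The interiors are disjoint subsets of \<open>U\<close>, so the total length
        is below \<delta> and absolute continuity applies.\<close>
      have "(\<Sum>z\<in>q. Sup (snd z) - Inf (snd z)) = (\<Sum>z\<in>q. measure lebesgue {Inf (snd z)<..<Sup (snd z)})"
        using Kq by (intro sum.cong) auto
      also have "\<dots> = measure lebesgue (\<Union>z\<in>q. {Inf (snd z)<..<Sup (snd z)})"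
        by (rule measure_finite_Union[symmetric]) (use finq dis Kq in auto)
      also have "\<dots> \<le> measure lebesgue U"
        using Kq U finq by (intro measure_mono_fmeasurable) auto
      finally have small: "(\<Sum>z\<in>q. Sup (snd z) - Inf (snd z)) < \<delta>" using U by linarith
      have "(\<Sum>z\<in>q. norm (g (Sup (snd z)) - g (Inf (snd z)))) < e / 2"
        by (rule \<delta>[OF finq _ dis small]) (use Kq in auto)
      moreover have "norm (\<Sum>z\<in>q. - (g (Sup (snd z)) - g (Inf (snd z)))) \<le> (\<Sum>z\<in>q. norm (g (Sup (snd z)) - g (Inf (snd z))))"
        by (intro sum_norm_le) (simp add: norm_minus_commute)
      ultimately have 2: "norm (\<Sum>z\<in>q. - (g (Sup (snd z)) - g (Inf (snd z)))) < e / 2"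
        by linarith
      show ?thesis
        unfolding case_prod_beta * using norm_triangle_lt[of _ _ e] 1 2 by (smt (verit) field_sum_of_halves)
    qed
    ultimately show "\<exists>\<gamma>. gauge \<gamma> \<and> (\<forall>\<D>. \<D> tagged_division_of cbox a b \<and> \<gamma> fine \<D> \<longrightarrow>
        norm ((\<Sum>(x, k)\<in>\<D>. measure lborel k *\<^sub>R G x) - (g b - g a)) < e)"
      by (intro exI[of _ D]) simp
  qed
  then show ?thesis
    by (rule has_integral_spike[OF N, rotated]) (auto simp: G_def)
qed

text \<open>The form in which calibrations are integrated: the derivative is compared with
  \<open>h\<close> off the null set, and overwriting \<open>g'\<close> by \<open>h\<close> on
  \<open>N\<close> makes the comparison hold everywhere.\<close>

corollary abs_cont_le_integral:
  fixes g :: "real \<Rightarrow> real"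
  assumes ab: "a \<le> b" and ac: "abs_cont_on {a..b} g" and N: "negligible N"
    and der: "\<And>t. t \<in> {a..b} - N \<Longrightarrow> (g has_real_derivative g' t) (at t within {a..b})"
    and le: "\<And>t. t \<in> {a..b} - N \<Longrightarrow> g' t \<le> h t" and h: "h integrable_on {a..b}"
  shows "g b - g a \<le> integral {a..b} h"
proof -
  have 1: "(g' has_integral g b - g a) {a..b}"
    by (rule has_integral_abs_cont[OF ab ac N]) (use der in \<open>auto simp: has_real_derivative_iff_has_vector_derivative\<close>)
  define g1 where "g1 t = (if t \<in> N then h t else g' t)" for t
  have "(g1 has_integral g b - g a) {a..b}"
    by (rule has_integral_spike[OF N _ 1]) (auto simp: g1_def)
  then show ?thesis
    using integrable_integral[OF h] by (rule has_integral_le) (use le in \<open>auto simp: g1_def\<close>)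
qed

section \<open>Closure properties of absolute continuity\<close>

lemma abs_cont_on_subset:
  assumes "abs_cont_on S g" "S' \<subseteq> S"
  shows "abs_cont_on S' g"
  unfolding abs_cont_on_def
proof (intro allI impI)
  fix \<epsilon> :: real assume "\<epsilon> > 0"
  with assms(1) obtain \<delta> where "\<delta> > 0" "\<And>(n::nat) a b. (\<forall>i<n. a i \<le> b i \<and> {a i..b i} \<subseteq> S) \<and>
        disjoint_family_on (\<lambda>i. {a i<..<b i}) {..<n} \<and> (\<Sum>i<n. b i - a i) < \<delta> \<Longrightarrow>
        (\<Sum>i<n. norm (g (b i) - g (a i))) < \<epsilon>"
    unfolding abs_cont_on_def by meson
  then show "\<exists>\<delta>>0. \<forall>(n::nat) a b. (\<forall>i<n. a i \<le> b i \<and> {a i..b i} \<subseteq> S') \<and>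
        disjoint_family_on (\<lambda>i. {a i<..<b i}) {..<n} \<and> (\<Sum>i<n. b i - a i) < \<delta> \<longrightarrow>
        (\<Sum>i<n. norm (g (b i) - g (a i))) < \<epsilon>"
    using assms(2) by (meson order_trans)
qed

text \<open>Common source of the closure properties: sums, differences, products, pairs and
  Lipschitz images have increments bounded by those of at most two absolutely continuous
  functions.\<close>

lemma abs_cont_on_dominated:
  fixes g1 :: "real \<Rightarrow> 'a::real_normed_vector" and g2 :: "real \<Rightarrow> 'b::real_normed_vector"
    and g :: "real \<Rightarrow> 'c::real_normed_vector"
  assumes "abs_cont_on S g1" "abs_cont_on S g2" "C \<ge> 0"
    and dom: "\<And>s t. s \<in> S \<Longrightarrow> t \<in> S \<Longrightarrow>
      norm (g t - g s) \<le> C * (norm (g1 t - g1 s) + norm (g2 t - g2 s))"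
  shows "abs_cont_on S g"
  unfolding abs_cont_on_def
proof (intro allI impI)
  fix \<epsilon> :: real assume "\<epsilon> > 0"
  \<comment> \<open>The summand 1 covers \<open>C = 0\<close> and makes the final inequality
    strict.\<close>
  define e where "e = \<epsilon> / (2 * (C + 1))"
  have "e > 0" using \<open>\<epsilon> > 0\<close> \<open>C \<ge> 0\<close> by (simp add: e_def)
  obtain \<delta>1 where 1: "\<delta>1 > 0" "\<And>(n::nat) a b. (\<forall>i<n. a i \<le> b i \<and> {a i..b i} \<subseteq> S) \<and>
        disjoint_family_on (\<lambda>i. {a i<..<b i}) {..<n} \<and> (\<Sum>i<n. b i - a i) < \<delta>1 \<Longrightarrow>
        (\<Sum>i<n. norm (g1 (b i) - g1 (a i))) < e"
    using assms(1) \<open>e > 0\<close> unfolding abs_cont_on_def by meson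
  obtain \<delta>2 where 2: "\<delta>2 > 0" "\<And>(n::nat) a b. (\<forall>i<n. a i \<le> b i \<and> {a i..b i} \<subseteq> S) \<and>
        disjoint_family_on (\<lambda>i. {a i<..<b i}) {..<n} \<and> (\<Sum>i<n. b i - a i) < \<delta>2 \<Longrightarrow>
        (\<Sum>i<n. norm (g2 (b i) - g2 (a i))) < e"
    using assms(2) \<open>e > 0\<close> unfolding abs_cont_on_def by meson
  have "(\<Sum>i<n. norm (g (b i) - g (a i))) < \<epsilon>"
    if "\<forall>i<n. a i \<le> b i \<and> {a i..b i} \<subseteq> S"
      "disjoint_family_on (\<lambda>i. {a i<..<b i}) {..<n}" "(\<Sum>i<n. b i - a i) < min \<delta>1 \<delta>2"
    for n and a b :: "nat \<Rightarrow> real"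
  proof -
    have "(\<Sum>i<n. norm (g (b i) - g (a i)))
        \<le> (\<Sum>i<n. C * (norm (g1 (b i) - g1 (a i)) + norm (g2 (b i) - g2 (a i))))"
      using that(1) by (intro sum_mono dom) force+
    also have "\<dots> = C * ((\<Sum>i<n. norm (g1 (b i) - g1 (a i))) + (\<Sum>i<n. norm (g2 (b i) - g2 (a i))))"
      by (simp add: sum_distrib_left sum.distrib distrib_left)
    also have "\<dots> \<le> C * (e + e)"
      using 1(2)[of n a b] 2(2)[of n a b] that \<open>C \<ge> 0\<close> by (intro mult_left_mono add_mono) auto
    also have "\<dots> < \<epsilon>"
    proof -
      have "C + 1 > 0" using \<open>C \<ge> 0\<close> by simp
      then have "\<epsilon> = 2 * (C + 1) * e" by (simp add: e_def)
      then show ?thesis using \<open>e > 0\<close> by (simp add: algebra_simps)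
    qed
    finally show ?thesis .
  qed
  then show "\<exists>\<delta>>0. \<forall>(n::nat) a b. (\<forall>i<n. a i \<le> b i \<and> {a i..b i} \<subseteq> S) \<and>
        disjoint_family_on (\<lambda>i. {a i<..<b i}) {..<n} \<and> (\<Sum>i<n. b i - a i) < \<delta> \<longrightarrow>
        (\<Sum>i<n. norm (g (b i) - g (a i))) < \<epsilon>"
    using 1(1) 2(1) by (intro exI[of _ "min \<delta>1 \<delta>2"] conjI allI impI) auto
qed

lemma abs_cont_on_id: "abs_cont_on S (\<lambda>t::real. t)"
  unfolding abs_cont_on_def
proof (intro allI impI, rule exI, intro conjI allI impI, assumption, elim conjE)
  fix \<epsilon> :: real and n :: nat and a b :: "nat \<Rightarrow> real"
  assume "\<forall>i<n. a i \<le> b i \<and> {a i..b i} \<subseteq> S" and *: "(\<Sum>i<n. b i - a i) < \<epsilon>"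
  then have "(\<Sum>i<n. norm (b i - a i)) = (\<Sum>i<n. b i - a i)"
    by (intro sum.cong) auto
  with * show "(\<Sum>i<n. norm (b i - a i)) < \<epsilon>" by simp
qed

lemma abs_cont_on_lipschitz_compose:
  assumes "abs_cont_on S g" "C \<ge> 0"
    and "\<And>s t. s \<in> S \<Longrightarrow> t \<in> S \<Longrightarrow> norm (F (g t) - F (g s)) \<le> C * norm (g t - g s)"
  shows "abs_cont_on S (\<lambda>t. F (g t))"
proof (rule abs_cont_on_dominated[OF assms(1,1,2)])
  fix s t assume "s \<in> S" "t \<in> S"
  then show "norm (F (g t) - F (g s)) \<le> C * (norm (g t - g s) + norm (g t - g s))"
    using assms(2) assms(3)[of s t] mult_nonneg_nonneg[of C "norm (g t - g s)"]
    unfolding distrib_left by (simp del: mult_nonneg_nonneg)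
qed

lemma abs_cont_on_lipschitz:
  assumes "C \<ge> 0" and "\<And>s t. s \<in> S \<Longrightarrow> t \<in> S \<Longrightarrow> norm (F t - F s) \<le> C * \<bar>t - s\<bar>"
  shows "abs_cont_on S F"
  using abs_cont_on_lipschitz_compose[OF abs_cont_on_id assms(1), of S F] assms(2) by simp

lemma abs_cont_on_C1:
  fixes F :: "real \<Rightarrow> real"
  assumes "\<And>t. t \<in> {a..b} \<Longrightarrow> (F has_real_derivative F' t) (at t within {a..b})"
    and "continuous_on {a..b} F'"
  shows "abs_cont_on {a..b} F"
proof -
  obtain B where B: "B > 0" "\<And>t. t \<in> {a..b} \<Longrightarrow> norm (F' t) \<le> B"
    using compact_continuous_image[OF assms(2)] compact_imp_bounded bounded_pos
    by (metis compact_Icc imageI)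
  show ?thesis
  proof (rule abs_cont_on_lipschitz)
    show "norm (F t - F s) \<le> B * \<bar>t - s\<bar>" if "s \<in> {a..b}" "t \<in> {a..b}" for s t
      using field_differentiable_bound[of "{a..b}" F F' B t s] assms(1) B that by simp
  qed (use B in simp)
qed

lemma abs_cont_on_const: "abs_cont_on S (\<lambda>_. c)"
  by (rule abs_cont_on_lipschitz[of 0]) auto

lemma abs_cont_on_cmult:
  fixes g :: "real \<Rightarrow> real"
  assumes "abs_cont_on S g"
  shows "abs_cont_on S (\<lambda>t. c * g t)"
  by (rule abs_cont_on_lipschitz_compose[OF assms, of "\<bar>c\<bar>"])
    (auto simp: abs_mult simp flip: right_diff_distrib)

lemma abs_cont_on_add:
  assumes "abs_cont_on S g1" "abs_cont_on S g2"
  shows "abs_cont_on S (\<lambda>t. g1 t + g2 t)"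
  by (rule abs_cont_on_dominated[OF assms, of 1]) (auto simp: add_diff_add norm_triangle_ineq)

lemma abs_cont_on_diff:
  assumes "abs_cont_on S g1" "abs_cont_on S g2"
  shows "abs_cont_on S (\<lambda>t. g1 t - g2 t)"
proof (rule abs_cont_on_dominated[OF assms, of 1])
  fix s t
  have "g1 t - g2 t - (g1 s - g2 s) = (g1 t - g1 s) - (g2 t - g2 s)" by simp
  then show "norm (g1 t - g2 t - (g1 s - g2 s)) \<le> 1 * (norm (g1 t - g1 s) + norm (g2 t - g2 s))"
    by (metis mult_1 norm_triangle_ineq4)
qed simp

lemma abs_cont_on_imp_continuous_on:
  assumes "abs_cont_on {a..b} g"
  shows "continuous_on {a..b} g"
  unfolding continuous_on_iff
proof (intro ballI allI impI)
  fix x e :: real assume x: "x \<in> {a..b}" and "e > 0"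
  from abs_cont_onE[OF assms \<open>e > 0\<close>, where 'i = unit]
  obtain \<delta> where "\<delta> > 0" and \<delta>: "\<And>(I::unit set) a' b'. \<lbrakk>finite I; \<And>i. i \<in> I \<Longrightarrow> a' i \<le> b' i \<and> {a' i..b' i} \<subseteq> {a..b};
        disjoint_family_on (\<lambda>i. {a' i<..<b' i}) I; (\<Sum>i\<in>I. b' i - a' i) < \<delta>\<rbrakk>
      \<Longrightarrow> (\<Sum>i\<in>I. norm (g (b' i) - g (a' i))) < e" by blast
  have "dist (g y) (g x) < e" if "y \<in> {a..b}" "dist y x < \<delta>" for y
    using \<delta>[of "{()}" "\<lambda>_. min x y" "\<lambda>_. max x y"] that x
    by (cases "x \<le> y") (auto simp: dist_norm disjoint_family_on_def norm_minus_commute)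
  then show "\<exists>d>0. \<forall>y\<in>{a..b}. dist y x < d \<longrightarrow> dist (g y) (g x) < e"
    using \<open>\<delta> > 0\<close> by blast
qed

lemma abs_cont_on_mult:
  fixes g1 g2 :: "real \<Rightarrow> real"
  assumes "abs_cont_on {a..b} g1" "abs_cont_on {a..b} g2"
  shows "abs_cont_on {a..b} (\<lambda>t. g1 t * g2 t)"
proof -
  have bd: "\<exists>B>0. \<forall>t\<in>{a..b}. \<bar>g t\<bar> \<le> B" if "abs_cont_on {a..b} g" for g :: "real \<Rightarrow> real"
    using compact_continuous_image[OF abs_cont_on_imp_continuous_on[OF that]] compact_imp_bounded
      bounded_pos by (metis compact_Icc imageI real_norm_def)
  obtain B1 where B1: "B1 > 0" "\<forall>t\<in>{a..b}. \<bar>g1 t\<bar> \<le> B1" using bd[OF assms(1)] by blast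
  obtain B2 where B2: "B2 > 0" "\<forall>t\<in>{a..b}. \<bar>g2 t\<bar> \<le> B2" using bd[OF assms(2)] by blast
  show ?thesis
  proof (rule abs_cont_on_dominated[OF assms, of "B1 + B2"])
    fix s t assume st: "s \<in> {a..b}" "t \<in> {a..b}"
    have "g1 t * g2 t - g1 s * g2 s = g1 t * (g2 t - g2 s) + g2 s * (g1 t - g1 s)"
      by (simp add: algebra_simps)
    then have "norm (g1 t * g2 t - g1 s * g2 s) \<le> \<bar>g1 t\<bar> * \<bar>g2 t - g2 s\<bar> + \<bar>g2 s\<bar> * \<bar>g1 t - g1 s\<bar>"
      by (metis abs_mult norm_triangle_ineq real_norm_def)
    also have "\<dots> \<le> (B1 + B2) * \<bar>g2 t - g2 s\<bar> + (B1 + B2) * \<bar>g1 t - g1 s\<bar>"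
      using B1 B2 st by (intro add_mono mult_right_mono) (smt (verit) abs_ge_zero)+
    finally show "norm (g1 t * g2 t - g1 s * g2 s) \<le> (B1 + B2) * (norm (g1 t - g1 s) + norm (g2 t - g2 s))"
      by (simp add: algebra_simps)
  qed (use B1 B2 in simp)
qed

lemma norm_fst_snd_le: "norm (fst p) \<le> norm p" "norm (snd p) \<le> norm p"
  for p :: "'a::real_normed_vector \<times> 'b::real_normed_vector"
  by (metis norm_fst_le surjective_pairing, metis norm_snd_le surjective_pairing)

lemma abs_cont_on_fst: "abs_cont_on S g \<Longrightarrow> abs_cont_on S (\<lambda>t. fst (g t))"
  by (rule abs_cont_on_lipschitz_compose[of S g 1]) (auto simp: norm_fst_snd_le simp flip: fst_diff)

lemma abs_cont_on_snd: "abs_cont_on S g \<Longrightarrow> abs_cont_on S (\<lambda>t. snd (g t))"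
  by (rule abs_cont_on_lipschitz_compose[of S g 1]) (auto simp: norm_fst_snd_le simp flip: snd_diff)

lemma abs_cont_on_Pair:
  assumes "abs_cont_on S g1" "abs_cont_on S g2"
  shows "abs_cont_on S (\<lambda>t. (g1 t, g2 t))"
  by (rule abs_cont_on_dominated[OF assms, of 1]) (auto simp: norm_Pair_le)

section \<open>Continuous clocks\<close>

text \<open>Meant for continuous approximations of a measurable function, which converge only off a
  null set. All functions are set to 0 on \<open>N\<close>.\<close>

lemma dominated_convergence_negligible:
  fixes f :: "nat \<Rightarrow> 'n::euclidean_space \<Rightarrow> 'm::euclidean_space"
  assumes N: "negligible N" and f: "\<And>k. f k integrable_on S" and h: "h integrable_on S"
    and le: "\<And>k x. x \<in> S - N \<Longrightarrow> norm (f k x) \<le> h x"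
    and conv: "\<And>x. x \<in> S - N \<Longrightarrow> (\<lambda>k. f k x) \<longlonglongrightarrow> g x"
  shows "g integrable_on S" "(\<lambda>k. integral S (f k)) \<longlonglongrightarrow> integral S g"
proof -
  define z where "z \<phi> x = (if x \<in> N then 0 else \<phi> x)" for \<phi> :: "'n \<Rightarrow> 'm" and x
  have f': "z (f k) integrable_on S" for k
    by (rule integrable_spike[OF f N]) (auto simp: z_def)
  have h': "(\<lambda>x. if x \<in> N then 0 else h x) integrable_on S"
    by (rule integrable_spike[OF h N]) auto
  have le': "norm (z (f k) x) \<le> (if x \<in> N then 0 else h x)" if "x \<in> S" for k x
    using le that by (simp add: z_def)
  have conv': "(\<lambda>k. z (f k) x) \<longlonglongrightarrow> z g x" if "x \<in> S" for x
    using conv that by (simp add: z_def)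
  note * = dominated_convergence[OF f' h' le' conv']
  show "g integrable_on S"
    by (rule integrable_spike[OF *(1) N]) (auto simp: z_def)
  have "integral S (z \<phi>) = integral S \<phi>" for \<phi>
    by (rule integral_spike[OF N]) (auto simp: z_def)
  then show "(\<lambda>k. integral S (f k)) \<longlonglongrightarrow> integral S g"
    using *(2) by simp
qed

text \<open>A continuous substitute for the clock \<open>\<integral> \<sigma>\<close>: the ideal choice \<open>m = (\<sigma> + \<delta>) / c\<close>
  is only measurable.\<close>

lemma continuous_clock:
  fixes \<sigma> :: "real \<Rightarrow> real"
  assumes T: "0 < T" and c: "0 < c" and \<tau>: "0 < \<tau>"
    and \<sigma>: "\<sigma> integrable_on {0..T}" and \<sigma>2: "(\<lambda>t. (\<sigma> t)\<^sup>2) integrable_on {0..T}"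
    and nonneg: "\<And>t. t \<in> {0..T} \<Longrightarrow> 0 \<le> \<sigma> t"
    and less: "integral {0..T} \<sigma> < c * \<tau>"
  obtains m where "continuous_on {0..T} m" "\<And>t. t \<in> {0..T} \<Longrightarrow> 0 < m t"
    "integral {0..T} m = \<tau>" "(\<lambda>t. (\<sigma> t)\<^sup>2 / m t) integrable_on {0..T}"
    "integral {0..T} (\<lambda>t. (\<sigma> t)\<^sup>2 / m t) < c\<^sup>2 * \<tau>"
proof -
  define L where "L = integral {0..T} \<sigma>"
  \<comment> \<open>\<open>\<delta> * T\<close> is half of the gap \<open>c * \<tau> - L\<close>, so
    \<open>\<sigma> + \<delta>\<close> still integrates to less than
    \<open>c * \<tau>\<close>.\<close>
  define \<delta> where "\<delta> = (c * \<tau> - L) / (2 * T)"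
  have \<delta>: "\<delta> > 0" using less T by (simp add: \<delta>_def L_def)
  have \<delta>T: "\<delta> * T + L < c * \<tau>"
    using less T by (simp add: \<delta>_def L_def field_simps)
  have \<sigma>m: "\<sigma> \<in> borel_measurable (lebesgue_on {0..T})"
    using integrable_imp_measurable[OF \<sigma>] .
  have dom: "(\<lambda>t. (\<sigma> t)\<^sup>2 / \<delta>) integrable_on {0..T}"
    using integrable_on_cmult_left[OF \<sigma>2, of "1/\<delta>"] by simp
  have quot: "(\<lambda>t. (\<sigma> t)\<^sup>2 / k t) integrable_on {0..T}"
    if "k \<in> borel_measurable (lebesgue_on {0..T})" "\<And>t. t \<in> {0..T} \<Longrightarrow> \<delta> \<le> k t" for k
  proof (rule measurable_bounded_by_integrable_imp_integrable[OF _ dom])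
    show "(\<lambda>t. (\<sigma> t)\<^sup>2 / k t) \<in> borel_measurable (lebesgue_on {0..T})"
      using \<sigma>m that(1) by measurable
    show "norm ((\<sigma> t)\<^sup>2 / k t) \<le> (\<sigma> t)\<^sup>2 / \<delta>" if "t \<in> {0..T}" for t
      using \<open>\<And>t. t \<in> {0..T} \<Longrightarrow> \<delta> \<le> k t\<close>[OF that] \<delta> by (simp add: divide_left_mono)
  qed auto
  \<comment> \<open>Truncating \<sigma> at a large \<open>M\<close> barely changes this integral,
    and the truncated clock rate is bounded, as dominated convergence for its approximations
    requires.\<close>
  have "(\<lambda>n. integral {0..T} (\<lambda>t. (\<sigma> t)\<^sup>2 / (\<delta> + min (\<sigma> t) (real n))))
      \<longlonglongrightarrow> integral {0..T} (\<lambda>t. (\<sigma> t)\<^sup>2 / (\<delta> + \<sigma> t))"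
  proof (rule dominated_convergence(2)[OF _ dom])
    show "(\<lambda>t. (\<sigma> t)\<^sup>2 / (\<delta> + min (\<sigma> t) (real n))) integrable_on {0..T}" for n
      using \<sigma>m nonneg by (intro quot) (measurable, auto simp: min_def)
    show "norm ((\<sigma> t)\<^sup>2 / (\<delta> + min (\<sigma> t) (real n))) \<le> (\<sigma> t)\<^sup>2 / \<delta>" if "t \<in> {0..T}" for n t
      using nonneg[OF that] \<delta> by (simp add: divide_left_mono)
    show "(\<lambda>n. (\<sigma> t)\<^sup>2 / (\<delta> + min (\<sigma> t) (real n))) \<longlonglongrightarrow> (\<sigma> t)\<^sup>2 / (\<delta> + \<sigma> t)" for t
    proof (rule tendsto_eventually)
      obtain n0 where "\<sigma> t \<le> real n0" using real_arch_simple by blast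
      then show "\<forall>\<^sub>F n in sequentially. (\<sigma> t)\<^sup>2 / (\<delta> + min (\<sigma> t) (real n)) = (\<sigma> t)\<^sup>2 / (\<delta> + \<sigma> t)"
        by (intro eventually_sequentiallyI[of n0]) (simp add: min_def)
    qed
  qed
  moreover have "integral {0..T} (\<lambda>t. (\<sigma> t)\<^sup>2 / (\<delta> + \<sigma> t)) \<le> L"
    unfolding L_def
  proof (rule integral_le[OF _ \<sigma>])
    show "(\<lambda>t. (\<sigma> t)\<^sup>2 / (\<delta> + \<sigma> t)) integrable_on {0..T}"
      using \<sigma>m nonneg by (intro quot) (measurable, auto)
    show "(\<sigma> t)\<^sup>2 / (\<delta> + \<sigma> t) \<le> \<sigma> t" if "t \<in> {0..T}" for t
      using nonneg[OF that] \<delta> by (simp add: divide_le_eq power2_eq_square algebra_simps)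
  qed
  then have "integral {0..T} (\<lambda>t. (\<sigma> t)\<^sup>2 / (\<delta> + \<sigma> t)) < c * \<tau>"
    using less by (simp add: L_def)
  ultimately have "\<forall>\<^sub>F n in sequentially. integral {0..T} (\<lambda>t. (\<sigma> t)\<^sup>2 / (\<delta> + min (\<sigma> t) (real n))) < c * \<tau>"
    by (rule order_tendstoD(2))
  then obtain M :: nat where M: "integral {0..T} (\<lambda>t. (\<sigma> t)\<^sup>2 / (\<delta> + min (\<sigma> t) (real M))) < c * \<tau>"
    by (auto simp: eventually_sequentially)
  have "\<sigma> measurable_on {0..T}"
    using \<sigma>m by (simp add: measurable_on_iff_borel_measurable)
  then obtain N g where N: "negligible N" and g: "\<And>n. continuous_on UNIV (g n)"
    and lim: "\<And>t. t \<notin> N \<Longrightarrow> (\<lambda>n::nat. g n t) \<longlonglongrightarrow> (if t \<in> {0..T} then \<sigma> t else 0)"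
    unfolding measurable_on_def by blast
  \<comment> \<open>The approximations \<open>g n\<close> come without bounds. Clipping them to the
    range of the truncated \<sigma> leaves the limit unchanged and keeps the rate at least
    \<delta>.\<close>
  define m where "m n t = \<delta> + min (max 0 (g n t)) (real M)" for n t
  have m_cont: "continuous_on A (m n)" for n A
    unfolding m_def by (intro continuous_intros continuous_on_subset[OF g]) auto
  have m_ge: "\<delta> \<le> m n t" and m_le: "m n t \<le> \<delta> + M" for n t by (auto simp: m_def)
  have m_lim: "(\<lambda>n. m n t) \<longlonglongrightarrow> \<delta> + min (\<sigma> t) (real M)" if "t \<in> {0..T} - N" for t
  proof -
    have "(\<lambda>n. m n t) \<longlonglongrightarrow> \<delta> + min (max 0 (\<sigma> t)) (real M)"
      unfolding m_def using lim[of t] that by (intro tendsto_intros) auto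
    then show ?thesis using nonneg[of t] that by (simp add: max_def)
  qed
  have m_meas: "m n \<in> borel_measurable (lebesgue_on {0..T})" for n
    by (rule continuous_imp_measurable_on_sets_lebesgue[OF m_cont]) simp
  have m_int: "m n integrable_on {0..T}" for n
    by (rule integrable_continuous_real[OF m_cont])
  have m_norm: "norm (m n t) \<le> \<delta> + real M" for n t
    using m_ge[of n t] m_le[of n t] \<delta> by simp
  have mi: "(\<lambda>t. \<delta> + min (\<sigma> t) (real M)) integrable_on {0..T}"
    by (rule dominated_convergence_negligible(1)[OF N m_int integrable_const_ivl m_norm m_lim])
  have "(\<lambda>n. integral {0..T} (m n)) \<longlonglongrightarrow> integral {0..T} (\<lambda>t. \<delta> + min (\<sigma> t) (real M))"
    by (rule dominated_convergence_negligible(2)[OF N m_int integrable_const_ivl m_norm m_lim])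
  moreover have "integral {0..T} (\<lambda>t. \<delta> + min (\<sigma> t) (real M)) \<le> integral {0..T} (\<lambda>t. \<delta> + \<sigma> t)"
    by (intro integral_le mi integrable_add \<sigma>) auto
  then have "integral {0..T} (\<lambda>t. \<delta> + min (\<sigma> t) (real M)) < c * \<tau>"
    using \<delta>T T integral_add[OF integrable_const_ivl \<sigma>, of \<delta>] by (simp add: L_def mult.commute)
  ultimately have e1: "\<forall>\<^sub>F n in sequentially. integral {0..T} (m n) < c * \<tau>"
    by (rule order_tendstoD(2))
  have "(\<lambda>n. integral {0..T} (\<lambda>t. (\<sigma> t)\<^sup>2 / m n t))
      \<longlonglongrightarrow> integral {0..T} (\<lambda>t. (\<sigma> t)\<^sup>2 / (\<delta> + min (\<sigma> t) (real M)))"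
  proof (rule dominated_convergence_negligible(2)[OF N _ dom])
    show "(\<lambda>t. (\<sigma> t)\<^sup>2 / m n t) integrable_on {0..T}" for n
      by (rule quot[OF m_meas m_ge])
    show "norm ((\<sigma> t)\<^sup>2 / m n t) \<le> (\<sigma> t)\<^sup>2 / \<delta>" for n t
      using m_ge[of n t] \<delta> by (simp add: divide_left_mono)
    show "(\<lambda>n. (\<sigma> t)\<^sup>2 / m n t) \<longlonglongrightarrow> (\<sigma> t)\<^sup>2 / (\<delta> + min (\<sigma> t) (real M))"
      if "t \<in> {0..T} - N" for t
      using nonneg[of t] that \<delta> by (intro tendsto_divide tendsto_const m_lim) auto
  qed
  then have e2: "\<forall>\<^sub>F n in sequentially. integral {0..T} (\<lambda>t. (\<sigma> t)\<^sup>2 / m n t) < c * \<tau>"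
    using M by (rule order_tendstoD(2))
  obtain n where n: "integral {0..T} (m n) < c * \<tau>" "integral {0..T} (\<lambda>t. (\<sigma> t)\<^sup>2 / m n t) < c * \<tau>"
    using eventually_conj[OF e1 e2] by (auto simp: eventually_sequentially)
  \<comment> \<open>Rescaling the rate by \<open>\<tau> / I\<close> makes the total time exactly
    \<tau> and multiplies \<open>J\<close> by \<open>I / \<tau>\<close>. It therefore suffices that
    \<open>I\<close> and \<open>J\<close> are both below \<open>c * \<tau>\<close>.\<close>
  define I where "I = integral {0..T} (m n)"
  define J where "J = integral {0..T} (\<lambda>t. (\<sigma> t)\<^sup>2 / m n t)"
  have "integral {0..T} (\<lambda>t. \<delta>) \<le> I"
    unfolding I_def by (intro integral_le m_int) (use m_ge in auto)
  moreover have "integral {0..T} (\<lambda>t. \<delta>) = \<delta> * T" using T by simp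
  ultimately have I: "I > 0" using mult_pos_pos[OF \<delta> T] by linarith
  show thesis
  proof
    show "continuous_on {0..T} (\<lambda>t. \<tau> / I * m n t)"
      by (intro continuous_intros m_cont)
    show "0 < \<tau> / I * m n t" for t
      using \<tau> I m_ge[of n t] \<delta> by simp
    show "integral {0..T} (\<lambda>t. \<tau> / I * m n t) = \<tau>"
      using I by (simp add: I_def)
    have eq: "(\<lambda>t. (\<sigma> t)\<^sup>2 / (\<tau> / I * m n t)) = (\<lambda>t. I / \<tau> * ((\<sigma> t)\<^sup>2 / m n t))"
      by (simp add: fun_eq_iff)
    show "(\<lambda>t. (\<sigma> t)\<^sup>2 / (\<tau> / I * m n t)) integrable_on {0..T}"
      unfolding eq by (intro integrable_on_mult_right quot m_meas m_ge)
    have "I * J < (c * \<tau>) * (c * \<tau>)"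
    proof (rule mult_strict_mono)
      have "0 \<le> J" unfolding J_def
        by (intro integral_nonneg quot m_meas m_ge divide_nonneg_nonneg zero_le_power2
            order_trans[OF less_imp_le[OF \<delta>] m_ge])
      then show "0 \<le> J" .
    qed (use n I c \<tau> in \<open>auto simp: I_def J_def\<close>)
    then have "I / \<tau> * J < c\<^sup>2 * \<tau>"
      using \<tau> by (simp add: field_simps power2_eq_square)
    then show "integral {0..T} (\<lambda>t. (\<sigma> t)\<^sup>2 / (\<tau> / I * m n t)) < c\<^sup>2 * \<tau>"
      unfolding eq integral_mult_right J_def .
  qed
qed

section \<open>Admissible curves\<close>

lemma classF_D:
  assumes "classF f"
  shows classF_zero: "f 0 = 0" and classF_pos: "\<And>r. r > 0 \<Longrightarrow> f r > 0"
    and classF_continuous: "continuous_on {0..} f"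
    and classF_deriv: "\<And>r. r > 0 \<Longrightarrow> (f has_real_derivative deriv f r) (at r)"
  using assms unfolding classF_def by (auto, metis DERIV_imp_deriv)

lemma rad_nonneg: "0 \<le> rad q" by (simp add: rad_def)

lemma rad_eq_0_iff: "rad q = 0 \<longleftrightarrow> fst q = 0 \<and> fst (snd q) = 0"
  by (simp add: rad_def)

lemma classF_rad_eq_0_iff: "classF f \<Longrightarrow> f (rad q) = 0 \<longleftrightarrow> rad q = 0"
  using classF_zero classF_pos[of f "rad q"] rad_nonneg[of q] by (metis less_irrefl order_le_less)

lemma continuous_on_f_rad:
  assumes "classF f" "continuous_on S \<gamma>"
  shows "continuous_on S (\<lambda>t. f (rad (\<gamma> t)))"
proof (rule continuous_on_compose2[OF classF_continuous[OF assms(1)]])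
  show "continuous_on S (\<lambda>t. rad (\<gamma> t))"
    unfolding rad_def by (intro continuous_intros assms(2))
qed (auto simp: rad_nonneg)

text \<open>Where \<open>f\<close> vanishes, the division by zero in \<open>speed\<close> drops the third control, hence \<open>d = 0\<close> there.\<close>

lemma admissible_velocity:
  assumes f: "classF f" and adm: "admissible f T \<gamma>" and T: "0 < T"
  obtains N a b d where "negligible N"
    "\<And>t. t \<in> {0..T} - N \<Longrightarrow> ((\<lambda>t. fst (\<gamma> t)) has_real_derivative a t) (at t within {0..T})"
    "\<And>t. t \<in> {0..T} - N \<Longrightarrow> ((\<lambda>t. fst (snd (\<gamma> t))) has_real_derivative b t) (at t within {0..T})"
    "\<And>t. t \<in> {0..T} - N \<Longrightarrow>
        ((\<lambda>t. snd (snd (\<gamma> t))) has_real_derivative d t * f (rad (\<gamma> t))) (at t within {0..T})"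
    "\<And>t. t \<in> {0..T} - N \<Longrightarrow> speed f T \<gamma> t = sqrt ((a t)\<^sup>2 + (b t)\<^sup>2 + (d t)\<^sup>2)"
    "\<And>t. rad (\<gamma> t) = 0 \<Longrightarrow> d t = 0"
    "speed f T \<gamma> integrable_on {0..T}" "(\<lambda>t. (speed f T \<gamma> t)\<^sup>2) integrable_on {0..T}"
proof -
  obtain u1 u2 u3 N where
    meas: "u1 measurable_on {0..T}" "u2 measurable_on {0..T}" "u3 measurable_on {0..T}"
    and int: "(\<lambda>t. (u1 t)\<^sup>2) integrable_on {0..T}" "(\<lambda>t. (u2 t)\<^sup>2) integrable_on {0..T}"
        "(\<lambda>t. (u3 t)\<^sup>2) integrable_on {0..T}"
    and N: "negligible N"
    and der: "\<And>t. t \<in> {0..T} - N \<Longrightarrow>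
           (\<gamma> has_vector_derivative (u1 t, u2 t, u3 t * f (rad (\<gamma> t)))) (at t within {0..T})"
    using adm unfolding admissible_def by blast
  define d where "d t = (if f (rad (\<gamma> t)) = 0 then 0 else u3 t)" for t
  define \<sigma> where "\<sigma> t = sqrt ((u1 t)\<^sup>2 + (u2 t)\<^sup>2 + (d t)\<^sup>2)" for t
  have d_eq: "u3 t * f (rad (\<gamma> t)) = d t * f (rad (\<gamma> t))" for t by (simp add: d_def)
  have vd: "vector_derivative \<gamma> (at t within {0..T}) = (u1 t, u2 t, d t * f (rad (\<gamma> t)))"
    if "t \<in> {0..T} - N" for t
    using vector_derivative_within_cbox[OF T, of t \<gamma>] der[OF that] that d_eq by simp
  have sp: "speed f T \<gamma> t = \<sigma> t" if "t \<in> {0..T} - N" for t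
    unfolding speed_def Let_def vd[OF that] \<sigma>_def by (simp add: d_def power_mult_distrib)
  have cont: "continuous_on {0..T} (\<lambda>t. f (rad (\<gamma> t)))"
    using adm f unfolding admissible_def by (intro continuous_on_f_rad abs_cont_on_imp_continuous_on) auto
  have [measurable]: "u1 \<in> borel_measurable (lebesgue_on {0..T})" "u2 \<in> borel_measurable (lebesgue_on {0..T})"
      "u3 \<in> borel_measurable (lebesgue_on {0..T})"
    using meas by (simp_all add: measurable_on_iff_borel_measurable)
  have [measurable]: "(\<lambda>t. f (rad (\<gamma> t))) \<in> borel_measurable (lebesgue_on {0..T})"
    by (rule continuous_imp_measurable_on_sets_lebesgue[OF cont]) simp
  have [measurable]: "d \<in> borel_measurable (lebesgue_on {0..T})"
    unfolding d_def by measurable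
  have \<sigma>m[measurable]: "\<sigma> \<in> borel_measurable (lebesgue_on {0..T})"
    unfolding \<sigma>_def by measurable
  have \<sigma>2: "(\<sigma> t)\<^sup>2 = (u1 t)\<^sup>2 + (u2 t)\<^sup>2 + (d t)\<^sup>2" for t
    by (simp add: \<sigma>_def)
  have d2: "(d t)\<^sup>2 \<le> (u3 t)\<^sup>2" for t by (simp add: d_def)
  have 2: "(\<lambda>t. (\<sigma> t)\<^sup>2) integrable_on {0..T}"
  proof (rule measurable_bounded_by_integrable_imp_integrable)
    show "(\<lambda>t. (u1 t)\<^sup>2 + (u2 t)\<^sup>2 + (u3 t)\<^sup>2) integrable_on {0..T}"
      by (intro integrable_add int)
  qed (use d2 in \<open>auto simp: \<sigma>2\<close>)
  have 1: "\<sigma> integrable_on {0..T}"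
  proof (rule measurable_bounded_by_integrable_imp_integrable)
    \<comment> \<open>On a bounded interval \<open>\<sigma> \<le> 1 + \<sigma>\<^sup>2\<close> turns
      square integrability into integrability.\<close>
    show "(\<lambda>t. 1 + (\<sigma> t)\<^sup>2) integrable_on {0..T}"
      by (intro integrable_add 2) auto
    show "norm (\<sigma> t) \<le> 1 + (\<sigma> t)\<^sup>2" for t
      using zero_le_power2[of "\<bar>\<sigma> t\<bar> - 1"] by (simp add: power2_diff)
  qed auto
  show thesis
  proof (rule that[OF N, of u1 u2 d])
    fix t assume t: "t \<in> {0..T} - N"
    note D = der[OF t, unfolded d_eq]
    have fs: "((\<lambda>t. fst (g t)) has_vector_derivative fst g') F" "((\<lambda>t. snd (g t)) has_vector_derivative snd g') F"
      if "(g has_vector_derivative g') F" for g :: "real \<Rightarrow> 'u::real_normed_vector \<times> 'v::real_normed_vector" and g' F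
      using bounded_linear.has_vector_derivative[OF bounded_linear_fst that]
        bounded_linear.has_vector_derivative[OF bounded_linear_snd that] by auto
    show "((\<lambda>t. fst (\<gamma> t)) has_real_derivative u1 t) (at t within {0..T})"
      using fs(1)[OF D] by (simp add: has_real_derivative_iff_has_vector_derivative)
    show "((\<lambda>t. fst (snd (\<gamma> t))) has_real_derivative u2 t) (at t within {0..T})"
      using fs(1)[OF fs(2)[OF D]] by (simp add: has_real_derivative_iff_has_vector_derivative)
    show "((\<lambda>t. snd (snd (\<gamma> t))) has_real_derivative d t * f (rad (\<gamma> t))) (at t within {0..T})"
      using fs(2)[OF fs(2)[OF D]] by (simp add: has_real_derivative_iff_has_vector_derivative)
    show "speed f T \<gamma> t = sqrt ((u1 t)\<^sup>2 + (u2 t)\<^sup>2 + (d t)\<^sup>2)"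
      using sp[OF t] by (simp add: \<sigma>_def)
  next
    show "d t = 0" if "rad (\<gamma> t) = 0" for t
      using that classF_zero[OF f] by (simp add: d_def)
    show "speed f T \<gamma> integrable_on {0..T}"
      by (rule integrable_spike[OF 1 N]) (use sp in auto)
    show "(\<lambda>t. (speed f T \<gamma> t)\<^sup>2) integrable_on {0..T}"
      by (rule integrable_spike[OF 2 N]) (use sp in auto)
  qed
qed

section \<open>Radius, planar displacement and length\<close>

lemma speed_nonneg: "0 \<le> speed f T \<gamma> t"
  unfolding speed_def Let_def by simp

lemma rad_eq_norm: "rad q = norm (fst q, fst (snd q))"
  by (simp add: rad_def norm_Pair)

lemma rad_square: "(rad q)\<^sup>2 = (fst q)\<^sup>2 + (fst (snd q))\<^sup>2"
  by (simp add: rad_def)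

lemma rad_lipschitz: "\<bar>rad p - rad q\<bar> \<le> sqrt ((fst p - fst q)\<^sup>2 + (fst (snd p) - fst (snd q))\<^sup>2)"
proof -
  have "\<bar>rad p - rad q\<bar> \<le> norm ((fst p, fst (snd p)) - (fst q, fst (snd q)))"
    unfolding rad_eq_norm by (rule norm_triangle_ineq3)
  then show ?thesis by (simp add: norm_Pair)
qed

lemma rad_lipschitz_norm: "\<bar>rad p - rad q\<bar> \<le> norm (p - q)"
proof -
  have "\<bar>rad p - rad q\<bar> \<le> sqrt ((fst p - fst q)\<^sup>2 + (fst (snd p) - fst (snd q))\<^sup>2)"
    by (rule rad_lipschitz)
  also have "\<dots> \<le> sqrt ((fst (p - q))\<^sup>2 + ((fst (snd (p - q)))\<^sup>2 + (snd (snd (p - q)))\<^sup>2))"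
    by simp
  also have "\<dots> = norm (p - q)"
    by (cases p, cases q) (simp add: norm_Pair)
  finally show ?thesis .
qed

text \<open>The curve is paired with its own planar displacement \<open>(p, q)\<close>;
  Cauchy-Schwarz bounds the derivative of the pairing by \<open>D * speed\<close>. This keeps short
  competitors near the radius of their starting point.\<close>

lemma planar_displacement_le_len:
  assumes f: "classF f" and adm: "admissible f T \<gamma>" and T: "0 < T" and t: "t \<in> {0..T}"
  shows "sqrt ((fst (\<gamma> t) - fst (\<gamma> 0))\<^sup>2 + (fst (snd (\<gamma> t)) - fst (snd (\<gamma> 0)))\<^sup>2) \<le> len f T \<gamma>"
proof -
  obtain N a b d where N: "negligible N"
    and a: "\<And>t. t \<in> {0..T} - N \<Longrightarrow> ((\<lambda>t. fst (\<gamma> t)) has_real_derivative a t) (at t within {0..T})"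
    and b: "\<And>t. t \<in> {0..T} - N \<Longrightarrow> ((\<lambda>t. fst (snd (\<gamma> t))) has_real_derivative b t) (at t within {0..T})"
    and "\<And>t. t \<in> {0..T} - N \<Longrightarrow>
        ((\<lambda>t. snd (snd (\<gamma> t))) has_real_derivative d t * f (rad (\<gamma> t))) (at t within {0..T})"
    and sp: "\<And>t. t \<in> {0..T} - N \<Longrightarrow> speed f T \<gamma> t = sqrt ((a t)\<^sup>2 + (b t)\<^sup>2 + (d t)\<^sup>2)"
    and "\<And>t. rad (\<gamma> t) = 0 \<Longrightarrow> d t = 0"
    and int: "speed f T \<gamma> integrable_on {0..T}" and "(\<lambda>t. (speed f T \<gamma> t)\<^sup>2) integrable_on {0..T}"
    by (rule admissible_velocity[OF f adm T]) (rule that)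
  define p where "p = fst (\<gamma> t) - fst (\<gamma> 0)"
  define q where "q = fst (snd (\<gamma> t)) - fst (snd (\<gamma> 0))"
  define D where "D = sqrt (p\<^sup>2 + q\<^sup>2)"
  have D2: "D\<^sup>2 = p\<^sup>2 + q\<^sup>2" by (simp add: D_def)
  have D0: "D \<ge> 0" by (simp add: D_def)
  have ac: "abs_cont_on {0..T} \<gamma>" using adm by (simp add: admissible_def)
  define g where "g t = p * fst (\<gamma> t) + q * fst (snd (\<gamma> t))" for t
  have "g t - g 0 \<le> integral {0..t} (\<lambda>s. D * speed f T \<gamma> s)"
  proof (rule abs_cont_le_integral[OF _ _ N])
    show "0 \<le> t" using t by simp
    have "abs_cont_on {0..t} \<gamma>" using ac t by (auto intro: abs_cont_on_subset)
    then show "abs_cont_on {0..t} g"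
      unfolding g_def by (intro abs_cont_on_add abs_cont_on_cmult abs_cont_on_fst abs_cont_on_snd)
    fix s assume "s \<in> {0..t} - N"
    with t have s: "s \<in> {0..T} - N" and sub: "{0..t} \<subseteq> {0..T}" by auto
    show "(g has_real_derivative p * a s + q * b s) (at s within {0..t})"
      unfolding g_def
      by (intro DERIV_add DERIV_cmult has_field_derivative_subset[OF a[OF s] sub]
          has_field_derivative_subset[OF b[OF s] sub])
    have "(p * a s + q * b s)\<^sup>2 \<le> (p\<^sup>2 + q\<^sup>2) * ((a s)\<^sup>2 + (b s)\<^sup>2)"
      using zero_le_power2[of "p * b s - q * a s"] by (simp add: power2_eq_square algebra_simps)
    also have "\<dots> \<le> (p\<^sup>2 + q\<^sup>2) * ((a s)\<^sup>2 + (b s)\<^sup>2 + (d s)\<^sup>2)"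
      by (intro mult_left_mono) auto
    also have "\<dots> = (D * speed f T \<gamma> s)\<^sup>2"
      by (simp add: sp[OF s] power_mult_distrib D2)
    finally show "p * a s + q * b s \<le> D * speed f T \<gamma> s"
      by (rule power2_le_imp_le) (simp add: D0 speed_nonneg)
  next
    show "(\<lambda>s. D * speed f T \<gamma> s) integrable_on {0..t}"
      using t by (intro integrable_on_mult_right integrable_on_subinterval[OF int]) auto
  qed
  also have "\<dots> = D * integral {0..t} (speed f T \<gamma>)" by simp
  also have "\<dots> \<le> D * integral {0..T} (speed f T \<gamma>)"
    using t D0 int by (intro mult_left_mono integral_subset_le integrable_on_subinterval[OF int])
      (auto simp: speed_nonneg)
  finally have "g t - g 0 \<le> D * len f T \<gamma>" by (simp add: len_def)
  moreover have "g t - g 0 = D\<^sup>2"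
    unfolding D2 by (simp add: g_def p_def q_def power2_eq_square algebra_simps)
  ultimately have *: "D * D \<le> D * len f T \<gamma>" by (simp add: power2_eq_square)
  \<comment> \<open>Cancelling \<open>D\<close> needs \<open>D \<noteq> 0\<close>; for
    \<open>D = 0\<close> the claim is this nonnegativity.\<close>
  have "0 \<le> len f T \<gamma>" unfolding len_def by (intro integral_nonneg int speed_nonneg)
  with * D0 have "D \<le> len f T \<gamma>" by (cases "D = 0") auto
  then show ?thesis by (simp add: D_def p_def q_def)
qed

lemma admissible_const: "admissible f T (\<lambda>_. p)" if "0 \<le> T"
  unfolding admissible_def
proof (intro conjI exI ballI)
  show "abs_cont_on {0..T} (\<lambda>_. p)" by (rule abs_cont_on_const)
  show "negligible {}" by simp
  have "(0, 0, 0) = (0 :: pt)" by (simp add: zero_prod_def)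
  then show "((\<lambda>_. p) has_vector_derivative (0, 0, 0 * f (rad p))) (at t within {0..T})" for t
    by (simp add: has_vector_derivative_const)
qed (use that in auto)

lemma len_const: "len f T (\<lambda>_. p) = 0" if "0 < T"
proof -
  have "speed f T (\<lambda>_. p) t = 0" if "t \<in> {0..T}" for t
    using vector_derivative_within_cbox[OF \<open>0 < T\<close>, of t "\<lambda>_. p" 0] that
    by (simp add: speed_def has_vector_derivative_const)
  then have "len f T (\<lambda>_. p) = integral {0..T} (\<lambda>_. 0)"
    unfolding len_def by (rule integral_cong)
  then show ?thesis by simp
qed

text \<open>A competitor with \<open>T' = 0\<close> joins equal endpoints, so a constant curve on \<open>[0, 1]\<close> replaces it.\<close>

lemma length_minimizerI:
  assumes adm: "admissible f T \<gamma>"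
    and min: "\<And>T' \<gamma>'. \<lbrakk>0 < T'; admissible f T' \<gamma>'; \<gamma>' 0 = \<gamma> 0; \<gamma>' T' = \<gamma> T\<rbrakk>
      \<Longrightarrow> len f T \<gamma> \<le> len f T' \<gamma>'"
  shows "length_minimizer f T \<gamma>"
  unfolding length_minimizer_def
proof (intro conjI adm allI impI, elim conjE)
  fix T' \<gamma>' assume *: "admissible f T' \<gamma>'" "\<gamma>' 0 = \<gamma> 0" "\<gamma>' T' = \<gamma> T"
  show "len f T \<gamma> \<le> len f T' \<gamma>'"
  proof (cases "T' = 0")
    case True
    then have "len f T \<gamma> \<le> len f 1 (\<lambda>_. \<gamma> 0)"
      using * by (intro min admissible_const) auto
    moreover have "len f T' \<gamma>' = 0" using True by (simp add: len_def)
    ultimately show ?thesis by (simp add: len_const)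
  next
    case False
    then show ?thesis using * min by (auto simp: admissible_def)
  qed
qed

section \<open>Regularity of the squared profile in the plane\<close>

text \<open>Condition (iii) bounds the derivative of \<open>f\<^sup>2\<close> above by a multiple of
  \<open>r\<close>, and the mean value theorem from 0 gives the quadratic bound. Only continuity of
  \<open>f\<close> at 0 enters at the left endpoint.\<close>

lemma f_square_le_near_0:
  assumes f: "classF f"
  obtains C \<delta> where "C \<ge> 0" "\<delta> > 0" "\<And>r. 0 \<le> r \<Longrightarrow> r < \<delta> \<Longrightarrow> (f r)\<^sup>2 \<le> C * r\<^sup>2"
proof -
  obtain L where L: "((\<lambda>r. f r * deriv f r / r) \<longlongrightarrow> L) (at_right 0)"
    using f unfolding classF_def by blast
  have "\<forall>\<^sub>F r in at_right 0. f r * deriv f r / r < \<bar>L\<bar> + 1"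
    by (rule order_tendstoD(2)[OF L]) auto
  then obtain \<delta> where \<delta>: "\<delta> > 0" "\<And>r. 0 < r \<Longrightarrow> r < \<delta> \<Longrightarrow> f r * deriv f r / r < \<bar>L\<bar> + 1"
    unfolding eventually_at_right_field by auto
  have "(f r)\<^sup>2 \<le> 2 * (\<bar>L\<bar> + 1) * r\<^sup>2" if r: "0 \<le> r" "r < \<delta>" for r
  proof (cases "r = 0")
    case True then show ?thesis using classF_zero[OF f] by simp
  next
    case False
    with r have "0 < r" by simp
    have "\<exists>l \<xi>. 0 < \<xi> \<and> \<xi> < r \<and> ((\<lambda>r. (f r)\<^sup>2) has_real_derivative l) (at \<xi>)
        \<and> (f r)\<^sup>2 - (f 0)\<^sup>2 = (r - 0) * l"
    proof (rule MVT[OF \<open>0 < r\<close>])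
      show "continuous_on {0..r} (\<lambda>r. (f r)\<^sup>2)"
        by (intro continuous_intros continuous_on_subset[OF classF_continuous[OF f]]) auto
      show "(\<lambda>r. (f r)\<^sup>2) differentiable (at \<xi>)" if "0 < \<xi>" for \<xi>
        using classF_deriv[OF f that] by (auto intro!: derivative_intros simp: real_differentiable_def)
    qed
    then obtain l \<xi> where \<xi>: "0 < \<xi>" "\<xi> < r" "((\<lambda>r. (f r)\<^sup>2) has_real_derivative l) (at \<xi>)"
      "(f r)\<^sup>2 = r * l" using classF_zero[OF f] by auto
    have "((\<lambda>r. (f r)\<^sup>2) has_real_derivative 2 * f \<xi> * deriv f \<xi>) (at \<xi>)"
      using DERIV_power[OF classF_deriv[OF f \<xi>(1)], of 2] by (simp add: algebra_simps)
    then have "l = 2 * (f \<xi> * deriv f \<xi>)" using DERIV_unique \<xi>(3) by (metis mult.assoc)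
    also have "f \<xi> * deriv f \<xi> \<le> (\<bar>L\<bar> + 1) * \<xi>"
      using \<delta>(2)[of \<xi>] \<xi> r by (simp add: field_simps)
    also have "\<dots> \<le> (\<bar>L\<bar> + 1) * r" using \<xi> by (intro mult_left_mono) auto
    finally have "r * l \<le> r * (2 * ((\<bar>L\<bar> + 1) * r))" using \<open>0 < r\<close> by (intro mult_left_mono) auto
    then show ?thesis using \<xi>(4) by (simp add: power2_eq_square algebra_simps)
  qed
  then show thesis using that[of "2 * (\<bar>L\<bar> + 1)" \<delta>] \<delta>(1) by auto
qed

text \<open>\<open>rad\<close> ignores the third coordinate, so \<open>z\<close> and
  \<open>z'\<close> are free and the rule fits curves with any height function.\<close>

lemma DERIV_rad:
  assumes x: "(x has_real_derivative x') (at t within S)" and y: "(y has_real_derivative y') (at t within S)"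
    and pos: "0 < rad (x t, y t, z)"
  shows "((\<lambda>t. rad (x t, y t, z' t)) has_real_derivative (x t * x' + y t * y') / rad (x t, y t, z)) (at t within S)"
proof -
  have "0 < (x t)\<^sup>2 + (y t)\<^sup>2" using pos by (simp add: rad_def)
  moreover have "((\<lambda>t. (x t)\<^sup>2 + (y t)\<^sup>2) has_real_derivative 2 * (x t * x' + y t * y')) (at t within S)"
    by (rule DERIV_cong[OF DERIV_add[OF DERIV_power[OF x, of 2] DERIV_power[OF y, of 2]]]) simp
  ultimately have "((\<lambda>t. sqrt ((x t)\<^sup>2 + (y t)\<^sup>2)) has_real_derivative
      (inverse (sqrt ((x t)\<^sup>2 + (y t)\<^sup>2)) / 2) * (2 * (x t * x' + y t * y'))) (at t within S)"
    by (rule DERIV_chain2[of sqrt, OF DERIV_real_sqrt])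
  moreover have "inverse s / 2 * (2 * X) = X / s" for s X :: real
    by (simp add: inverse_eq_divide)
  ultimately show ?thesis by (simp only: rad_def fst_conv snd_conv)
qed

lemma DERIV_f_square_rad:
  assumes f: "classF f"
    and x: "(x has_real_derivative x') (at t within S)" and y: "(y has_real_derivative y') (at t within S)"
  defines "r \<equiv> \<lambda>t. sqrt ((x t)\<^sup>2 + (y t)\<^sup>2)"
  shows "((\<lambda>t. (f (r t))\<^sup>2) has_real_derivative
    2 * f (r t) * deriv f (r t) * (x t * x' + y t * y') / r t) (at t within S)"
proof (cases "r t = 0")
  case False
  then have r: "r t > 0" by (simp add: r_def less_le)
  have R: "(r has_real_derivative (x t * x' + y t * y') / r t) (at t within S)"
    using DERIV_rad[OF x y, of 0] r by (simp add: rad_def r_def)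
  show ?thesis
    using DERIV_power[OF DERIV_chain2[OF classF_deriv[OF f r] R], of 2] by (simp add: algebra_simps)
next
  case True
  then have xy: "x t = 0" "y t = 0" by (simp_all add: r_def)
  obtain C \<delta> where C: "C \<ge> 0" "\<delta> > 0" "\<And>r. 0 \<le> r \<Longrightarrow> r < \<delta> \<Longrightarrow> (f r)\<^sup>2 \<le> C * r\<^sup>2"
    using f_square_le_near_0[OF f] by blast
  have "continuous (at t within S) r"
    unfolding r_def by (intro continuous_intros DERIV_continuous[OF x] DERIV_continuous[OF y])
  then have "\<forall>\<^sub>F s in at t within S. r s < \<delta>"
    using True C(2) by (intro order_tendstoD(2)[of r "r t"]) (auto simp: continuous_within)
  then have ev: "\<forall>\<^sub>F s in at t within S. norm (((f (r s))\<^sup>2 - (f (r t))\<^sup>2) / (s - t))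
      \<le> norm (C * (((r s)\<^sup>2 - (r t)\<^sup>2) / (s - t)))"
  proof eventually_elim
    case (elim s)
    have "(f (r s))\<^sup>2 \<le> C * (r s)\<^sup>2" using C(3)[of "r s"] elim by (simp add: r_def)
    then show ?case
      using True classF_zero[OF f] C(1) by (simp add: abs_mult divide_right_mono)
  qed
  have "((\<lambda>t. (x t)\<^sup>2 + (y t)\<^sup>2) has_real_derivative 0) (at t within S)"
    by (rule DERIV_cong[OF DERIV_add[OF DERIV_power[OF x, of 2] DERIV_power[OF y, of 2]]]) (simp add: xy)
  then have "((\<lambda>t. (r t)\<^sup>2) has_real_derivative 0) (at t within S)"
    by (simp add: r_def)
  then have "((\<lambda>s. C * (((r s)\<^sup>2 - (r t)\<^sup>2) / (s - t))) \<longlongrightarrow> C * 0) (at t within S)"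
    unfolding has_field_derivative_iff by (intro tendsto_mult tendsto_const)
  then have "((\<lambda>s. C * (((r s)\<^sup>2 - (r t)\<^sup>2) / (s - t))) \<longlongrightarrow> 0) (at t within S)" by simp
  from Lim_null_comparison[OF ev tendsto_norm_zero[OF this]]
  show ?thesis using True by (simp add: has_field_derivative_iff)
qed

text \<open>The annulus is not convex, so a Taylor expansion along the segment from \<open>p\<close>
  to \<open>q\<close> may leave it. In the variable \<rho>, the squared radius, the domain is an
  interval, and \<open>\<rho>' - \<rho>\<close> equals twice the inner product of \<open>p\<close>
  with the planar displacement plus the squared length of that displacement.\<close>

lemma f_square_semiconcave:
  assumes f: "classF f" and r0: "0 < r0"
  obtains K where "K \<ge> 0"
    "\<And>p q. \<lbrakk>rad p \<in> {r0/2..2*r0}; rad q \<in> {r0/2..2*r0}\<rbrakk> \<Longrightarrow>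
      (f (rad q))\<^sup>2 \<le> (f (rad p))\<^sup>2
        + 2 * (f (rad p) * deriv f (rad p) / rad p)
            * (fst p * (fst q - fst p) + fst (snd p) * (fst (snd q) - fst (snd p)))
        + K * ((fst q - fst p)\<^sup>2 + (fst (snd q) - fst (snd p))\<^sup>2)"
proof -
  obtain f1 f2 where f1: "\<And>r. r > 0 \<Longrightarrow> (f has_real_derivative f1 r) (at r)"
    and f2: "\<And>r. r > 0 \<Longrightarrow> (f1 has_real_derivative f2 r) (at r)"
    and f2c: "continuous_on {0<..} f2"
    using f unfolding classF_def by blast
  have df: "deriv f r = f1 r" if "r > 0" for r using f1[OF that] by (rule DERIV_imp_deriv)
  define I where "I = {(r0/2)\<^sup>2..(2*r0)\<^sup>2}"
  have Ipos: "\<rho> > 0" if "\<rho> \<in> I" for \<rho>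
    using that r0 unfolding I_def by (auto intro: less_le_trans[of 0 "(r0/2)\<^sup>2"])
  define g where "g = (\<lambda>\<rho>. (f (sqrt \<rho>))\<^sup>2)"
  define g1 where "g1 = (\<lambda>\<rho>. f (sqrt \<rho>) * f1 (sqrt \<rho>) / sqrt \<rho>)"
  define k2 where "k2 s = ((f1 s * f1 s + f2 s * f s) * s - f s * f1 s) / (s * s)" for s
  define g2 where "g2 = (\<lambda>\<rho>. k2 (sqrt \<rho>) * (inverse (sqrt \<rho>) / 2))"
  have sq: "(sqrt has_real_derivative inverse (sqrt \<rho>) / 2) (at \<rho>)" if "\<rho> > 0" for \<rho>
    using that by (rule DERIV_real_sqrt)
  have g1: "(g has_real_derivative g1 \<rho>) (at \<rho>)" if "\<rho> > 0" for \<rho>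
  proof -
    have "((\<lambda>\<rho>. f (sqrt \<rho>)) has_real_derivative f1 (sqrt \<rho>) * (inverse (sqrt \<rho>) / 2)) (at \<rho>)"
      by (rule DERIV_chain2[of f _ sqrt]) (use that f1 sq in auto)
    from DERIV_power[OF this, of 2] show ?thesis
      unfolding g_def g1_def by (rule DERIV_cong) (use that in \<open>simp add: field_simps\<close>)
  qed
  have k2: "((\<lambda>s. f s * f1 s / s) has_real_derivative k2 s) (at s)" if "s > 0" for s
    using DERIV_divide[OF DERIV_mult[OF f1[OF that] f2[OF that]] DERIV_ident] that
    by (simp add: k2_def)
  have g2: "(g1 has_real_derivative g2 \<rho>) (at \<rho>)" if "\<rho> > 0" for \<rho>
    unfolding g1_def g2_def
    by (rule DERIV_chain2[of "\<lambda>s. f s * f1 s / s" _ sqrt]) (use that k2 sq in auto)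
  have cf: "continuous_on {0<..} f"
    by (rule DERIV_continuous_on[where D = f1]) (simp add: f1 has_field_derivative_at_within)
  have cf1: "continuous_on {0<..} f1"
    by (rule DERIV_continuous_on[where D = f2]) (simp add: f2 has_field_derivative_at_within)
  have csq: "continuous_on I (\<lambda>\<rho>. k (sqrt \<rho>))" if "continuous_on {0<..} k" for k :: "real \<Rightarrow> real"
    by (rule continuous_on_compose2[OF that]) (use Ipos in \<open>auto intro!: continuous_intros\<close>)
  have g1c: "continuous_on I g1"
    unfolding g1_def by (rule csq[of "\<lambda>s. f s * f1 s / s"]) (use cf cf1 in \<open>auto intro!: continuous_intros\<close>)
  have "continuous_on I (\<lambda>\<rho>. k2 (sqrt \<rho>))"
    unfolding k2_def by (rule csq[of "\<lambda>s. ((f1 s * f1 s + f2 s * f s) * s - f s * f1 s) / (s * s)"]) (use cf cf1 f2c in \<open>auto intro!: continuous_intros\<close>)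
  moreover have "continuous_on I (\<lambda>\<rho>. inverse (sqrt \<rho>) / 2)"
    by (rule csq[of "\<lambda>s. inverse s / 2"]) (auto intro!: continuous_intros)
  ultimately have g2c: "continuous_on I g2"
    unfolding g2_def by (rule continuous_on_mult)
  have cpt: "compact I" by (simp add: I_def)
  obtain B where B: "B > 0" "\<And>\<rho>. \<rho> \<in> I \<Longrightarrow> \<bar>g1 \<rho>\<bar> \<le> B"
    using compact_imp_bounded[OF compact_continuous_image[OF g1c cpt]] by (auto simp: bounded_pos)
  obtain C where C: "C > 0" "\<And>\<rho>. \<rho> \<in> I \<Longrightarrow> \<bar>g2 \<rho>\<bar> \<le> C"
    using compact_imp_bounded[OF compact_continuous_image[OF g2c cpt]] by (auto simp: bounded_pos)
  \<comment> \<open>Since \<open>g2 \<le> C\<close>, the function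
    \<open>C / 2 * \<rho>\<^sup>2 - g \<rho>\<close> is convex and lies above its tangents.\<close>
  have taylor: "g \<rho>' \<le> g \<rho> + g1 \<rho> * (\<rho>' - \<rho>) + C / 2 * (\<rho>' - \<rho>)\<^sup>2" if "\<rho> \<in> I" "\<rho>' \<in> I" for \<rho> \<rho>'
  proof -
    have "(C * \<rho> - g1 \<rho>) * (\<rho>' - \<rho>) \<le> (C / 2 * \<rho>'\<^sup>2 - g \<rho>') - (C / 2 * \<rho>\<^sup>2 - g \<rho>)"
    proof (rule f''_imp_f'[of I "\<lambda>\<rho>. C / 2 * \<rho>\<^sup>2 - g \<rho>" "\<lambda>\<rho>. C * \<rho> - g1 \<rho>" "\<lambda>\<rho>. C - g2 \<rho>"])
      show "DERIV (\<lambda>\<rho>. C / 2 * \<rho>\<^sup>2 - g \<rho>) \<rho> :> C * \<rho> - g1 \<rho>" if "\<rho> \<in> I" for \<rho>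
        using Ipos[OF that] by (auto intro!: derivative_eq_intros g1)
      show "DERIV (\<lambda>\<rho>. C * \<rho> - g1 \<rho>) \<rho> :> C - g2 \<rho>" if "\<rho> \<in> I" for \<rho>
        using Ipos[OF that] by (auto intro!: derivative_eq_intros g2)
      show "0 \<le> C - g2 \<rho>" if "\<rho> \<in> I" for \<rho> using C(2)[OF that] by simp
    qed (use that in \<open>auto simp: I_def\<close>)
    then show ?thesis by (simp add: power2_eq_square field_simps)
  qed
  show thesis
  \<comment> \<open>\<open>B\<close> pays for \<open>g1\<close> times the squared displacement. The
    rest is \<open>C / 2\<close> times 16 times the squared \<open>r0\<close>, since the two radii
    add up to at most \<open>4 * r0\<close>.\<close>
  proof (rule that[of "B + 8 * C * r0\<^sup>2"])
    fix p q assume p: "rad p \<in> {r0/2..2*r0}" and q: "rad q \<in> {r0/2..2*r0}"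
    define h1 h2 where "h1 = fst q - fst p" and "h2 = fst (snd q) - fst (snd p)"
    define \<rho> \<rho>' where "\<rho> = (rad p)\<^sup>2" and "\<rho>' = (rad q)\<^sup>2"
    have I: "\<rho> \<in> I" "\<rho>' \<in> I"
      using p q r0 unfolding \<rho>_def \<rho>'_def I_def atLeastAtMost_iff by (intro conjI power_mono; simp)+
    have diff: "\<rho>' - \<rho> = 2 * (fst p * h1 + fst (snd p) * h2) + (h1\<^sup>2 + h2\<^sup>2)"
      unfolding \<rho>_def \<rho>'_def rad_square h1_def h2_def by (simp add: power2_eq_square algebra_simps)
    have "(\<rho>' - \<rho>)\<^sup>2 = (rad q - rad p)\<^sup>2 * (rad q + rad p)\<^sup>2"
      by (simp add: \<rho>_def \<rho>'_def power2_eq_square algebra_simps)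
    also have "\<dots> \<le> (h1\<^sup>2 + h2\<^sup>2) * (4 * r0)\<^sup>2"
    proof (rule mult_mono)
      have "\<bar>rad q - rad p\<bar> \<le> sqrt (h1\<^sup>2 + h2\<^sup>2)"
        using rad_lipschitz[of q p] by (simp add: h1_def h2_def)
      then show "(rad q - rad p)\<^sup>2 \<le> h1\<^sup>2 + h2\<^sup>2"
        using power_mono[of "\<bar>rad q - rad p\<bar>" "sqrt (h1\<^sup>2 + h2\<^sup>2)" 2] by simp
      show "(rad q + rad p)\<^sup>2 \<le> (4 * r0)\<^sup>2"
        using p q r0 by (intro power_mono) auto
    qed auto
    finally have sqb: "(\<rho>' - \<rho>)\<^sup>2 \<le> 16 * r0\<^sup>2 * (h1\<^sup>2 + h2\<^sup>2)"
      by (simp add: power_mult_distrib algebra_simps)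
    have rp: "rad p > 0" using p r0 by simp
    have "sqrt \<rho> = rad p" "sqrt \<rho>' = rad q" by (simp_all add: \<rho>_def \<rho>'_def rad_nonneg)
    then have g: "g \<rho> = (f (rad p))\<^sup>2" "g \<rho>' = (f (rad q))\<^sup>2" "g1 \<rho> = f (rad p) * deriv f (rad p) / rad p"
      using df[OF rp] by (simp_all add: g_def g1_def)
    have "g1 \<rho> * (h1\<^sup>2 + h2\<^sup>2) \<le> B * (h1\<^sup>2 + h2\<^sup>2)"
      using B(2)[OF I(1)] by (intro mult_right_mono) auto
    moreover have "C / 2 * (\<rho>' - \<rho>)\<^sup>2 \<le> C / 2 * (16 * r0\<^sup>2 * (h1\<^sup>2 + h2\<^sup>2))"
      using sqb C(1) by (intro mult_left_mono) auto
    moreover have "g \<rho>' \<le> g \<rho> + g1 \<rho> * (2 * (fst p * h1 + fst (snd p) * h2)) + g1 \<rho> * (h1\<^sup>2 + h2\<^sup>2)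
        + C / 2 * (\<rho>' - \<rho>)\<^sup>2"
      using taylor[OF I] unfolding diff by (simp add: distrib_left)
    ultimately have "g \<rho>' \<le> g \<rho> + 2 * g1 \<rho> * (fst p * h1 + fst (snd p) * h2) + (B + 8 * C * r0\<^sup>2) * (h1\<^sup>2 + h2\<^sup>2)"
      by (simp add: algebra_simps)
    then show "(f (rad q))\<^sup>2 \<le> (f (rad p))\<^sup>2
        + 2 * (f (rad p) * deriv f (rad p) / rad p)
            * (fst p * (fst q - fst p) + fst (snd p) * (fst (snd q) - fst (snd p)))
        + (B + 8 * C * r0\<^sup>2) * ((fst q - fst p)\<^sup>2 + (fst (snd q) - fst (snd p))\<^sup>2)"
      unfolding g h1_def h2_def .
  qed (use B C in auto)
qed

section \<open>Normal trajectories\<close>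

lemma hamilton_solD:
  assumes "hamilton_sol f T x y z u v w" "t \<in> {0..T}"
  shows "(x has_real_derivative u t) (at t within {0..T})"
    "(y has_real_derivative v t) (at t within {0..T})"
    "(z has_real_derivative (f (sqrt ((x t)\<^sup>2 + (y t)\<^sup>2)))\<^sup>2 * w t) (at t within {0..T})"
    "(u has_real_derivative - (w t)\<^sup>2 * f (sqrt ((x t)\<^sup>2 + (y t)\<^sup>2)) * deriv f (sqrt ((x t)\<^sup>2 + (y t)\<^sup>2)) * x t
        / sqrt ((x t)\<^sup>2 + (y t)\<^sup>2)) (at t within {0..T})"
    "(v has_real_derivative - (w t)\<^sup>2 * f (sqrt ((x t)\<^sup>2 + (y t)\<^sup>2)) * deriv f (sqrt ((x t)\<^sup>2 + (y t)\<^sup>2)) * y t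
        / sqrt ((x t)\<^sup>2 + (y t)\<^sup>2)) (at t within {0..T})"
    "(w has_real_derivative 0) (at t within {0..T})"
  using assms unfolding hamilton_sol_def Let_def by blast+

lemma DERIV_zero_imp_const:
  assumes "\<And>t. t \<in> {0..T} \<Longrightarrow> (g has_real_derivative 0) (at t within {0..T})" "t \<in> {0..T}"
  shows "g t = g (0::real)"
proof -
  have "0 \<in> {0..T}" using assms(2) by auto
  show ?thesis
    by (rule has_field_derivative_zero_constant[of "{0..T}" g, THEN exE])
      (use assms \<open>0 \<in> {0..T}\<close> in auto)
qed

lemma hamilton_sol_w_const:
  assumes "hamilton_sol f T x y z u v w" "t \<in> {0..T}"
  shows "w t = w 0"
  by (rule DERIV_zero_imp_const[OF hamilton_solD(6)[OF assms(1)] assms(2)])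

text \<open>The terms cancel algebraically with the quotient by \<open>r\<close> left in place, so
  times on the axis need no separate treatment.\<close>

lemma hamilton_sol_energy:
  assumes f: "classF f" and sol: "hamilton_sol f T x y z u v w" and t: "t \<in> {0..T}"
  defines "r \<equiv> \<lambda>t. sqrt ((x t)\<^sup>2 + (y t)\<^sup>2)"
    and "E \<equiv> \<lambda>t. (u t)\<^sup>2 + (v t)\<^sup>2 + (f (sqrt ((x t)\<^sup>2 + (y t)\<^sup>2)))\<^sup>2 * (w 0)\<^sup>2"
  shows "E t = E 0"
proof (rule DERIV_zero_imp_const[OF _ t])
  fix t assume t: "t \<in> {0..T}"
  note D = hamilton_solD[OF sol t, unfolded hamilton_sol_w_const[OF sol t]]
  show "(E has_real_derivative 0) (at t within {0..T})"
    unfolding E_def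
  proof (rule DERIV_cong)
    have sq: "((\<lambda>t. (g t)\<^sup>2) has_real_derivative 2 * (D * g t)) (at t within {0..T})"
      if "(g has_real_derivative D) (at t within {0..T})" for g D
      using DERIV_power[OF that, of 2] by simp
    show "((\<lambda>t. (u t)\<^sup>2 + (v t)\<^sup>2 + (f (sqrt ((x t)\<^sup>2 + (y t)\<^sup>2)))\<^sup>2 * (w 0)\<^sup>2) has_real_derivative
      2 * ((- (w 0)\<^sup>2 * f (r t) * deriv f (r t) * x t / r t) * u t)
      + 2 * ((- (w 0)\<^sup>2 * f (r t) * deriv f (r t) * y t / r t) * v t)
      + (2 * f (r t) * deriv f (r t) * (x t * u t + y t * v t) / r t) * (w 0)\<^sup>2) (at t within {0..T})"
      unfolding r_def
      by (rule DERIV_add[OF DERIV_add[OF sq[OF D(4)] sq[OF D(5)]]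
            DERIV_cmult_right[OF DERIV_f_square_rad[OF f D(1,2)]]])
    have "2 * ((- W * F * G * X / R) * U) + 2 * ((- W * F * G * Y / R) * V)
        + (2 * F * G * (X * U + Y * V) / R) * W = 0" for W F G X Y R U V :: real
      by (simp add: add_divide_distrib algebra_simps)
    then show "2 * ((- (w 0)\<^sup>2 * f (r t) * deriv f (r t) * x t / r t) * u t)
      + 2 * ((- (w 0)\<^sup>2 * f (r t) * deriv f (r t) * y t / r t) * v t)
      + (2 * f (r t) * deriv f (r t) * (x t * u t + y t * v t) / r t) * (w 0)\<^sup>2 = 0" .
  qed
qed

text \<open>Hamilton's equations are autonomous. The shift produces the arcs required at every
  starting time of a geodesic; with \<open>t = 0\<close> it restricts to a shorter interval.\<close>

lemma hamilton_sol_shift: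
  assumes sol: "hamilton_sol f T x y z u v w" and t: "0 \<le> t" "t + \<epsilon> \<le> T"
  shows "hamilton_sol f \<epsilon> (\<lambda>s. x (t + s)) (\<lambda>s. y (t + s)) (\<lambda>s. z (t + s))
    (\<lambda>s. u (t + s)) (\<lambda>s. v (t + s)) (\<lambda>s. w (t + s))"
proof -
  have shift: "((\<lambda>s. g (t + s)) has_real_derivative D) (at s within {0..\<epsilon>})"
    if "(g has_real_derivative D) (at (t + s) within {0..T})" "s \<in> {0..\<epsilon>}" for g :: "real \<Rightarrow> real" and D s
  proof -
    have sub: "(\<lambda>s. t + s) ` {0..\<epsilon>} \<subseteq> {0..T}" using t by auto
    have "((\<lambda>s. t + s) has_real_derivative 1) (at s within {0..\<epsilon>})"
      by (auto intro!: derivative_eq_intros)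
    from DERIV_image_chain[OF has_field_derivative_subset[OF that(1) sub] this]
    show ?thesis by (simp add: o_def)
  qed
  show ?thesis
    unfolding hamilton_sol_def Let_def
  proof (intro ballI conjI)
    fix s assume s: "s \<in> {0..\<epsilon>}"
    then have ts: "t + s \<in> {0..T}" using t by auto
    note D = hamilton_solD[OF sol ts]
    show "((\<lambda>s. x (t + s)) has_real_derivative u (t + s)) (at s within {0..\<epsilon>})" by (rule shift[OF D(1) s])
    show "((\<lambda>s. y (t + s)) has_real_derivative v (t + s)) (at s within {0..\<epsilon>})" by (rule shift[OF D(2) s])
    show "((\<lambda>s. z (t + s)) has_real_derivative (f (sqrt ((x (t + s))\<^sup>2 + (y (t + s))\<^sup>2)))\<^sup>2 * w (t + s))
      (at s within {0..\<epsilon>})" by (rule shift[OF D(3) s])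
    show "((\<lambda>s. u (t + s)) has_real_derivative - (w (t + s))\<^sup>2 * f (sqrt ((x (t + s))\<^sup>2 + (y (t + s))\<^sup>2))
      * deriv f (sqrt ((x (t + s))\<^sup>2 + (y (t + s))\<^sup>2)) * x (t + s) / sqrt ((x (t + s))\<^sup>2 + (y (t + s))\<^sup>2))
      (at s within {0..\<epsilon>})" by (rule shift[OF D(4) s])
    show "((\<lambda>s. v (t + s)) has_real_derivative - (w (t + s))\<^sup>2 * f (sqrt ((x (t + s))\<^sup>2 + (y (t + s))\<^sup>2))
      * deriv f (sqrt ((x (t + s))\<^sup>2 + (y (t + s))\<^sup>2)) * y (t + s) / sqrt ((x (t + s))\<^sup>2 + (y (t + s))\<^sup>2))
      (at s within {0..\<epsilon>})" by (rule shift[OF D(5) s])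
    show "((\<lambda>s. w (t + s)) has_real_derivative 0) (at s within {0..\<epsilon>})" by (rule shift[OF D(6) s])
  qed
qed

text \<open>The speed \<open>c\<close> is a parameter, so restrictions and shifted arcs share it;
  \<open>c > 0\<close> rules out constant curves.\<close>

locale normal_curve =
  fixes f :: "real \<Rightarrow> real" and T :: real and x y z u v w :: "real \<Rightarrow> real" and \<gamma> :: "real \<Rightarrow> pt" and c :: real
  assumes f: "classF f" and T: "0 < T" and sol: "hamilton_sol f T x y z u v w"
    and \<gamma>: "\<And>t. t \<in> {0..T} \<Longrightarrow> \<gamma> t = (x t, y t, z t)"
    and c: "0 < c"
    and energy: "\<And>t. t \<in> {0..T} \<Longrightarrow>
      (u t)\<^sup>2 + (v t)\<^sup>2 + (f (sqrt ((x t)\<^sup>2 + (y t)\<^sup>2)))\<^sup>2 * (w 0)\<^sup>2 = c\<^sup>2"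
begin

definition r :: "real \<Rightarrow> real" where "r t = sqrt ((x t)\<^sup>2 + (y t)\<^sup>2)"

text \<open>\<open>force\<close> times \<open>(x, y)\<close> is the gradient of the planar potential
  \<open>w\<^sup>2 f\<^sup>2 / 2\<close>.\<close>

definition force :: "real \<Rightarrow> real" where "force t = (w 0)\<^sup>2 * (f (r t) * deriv f (r t) / r t)"

lemma energy_r: "t \<in> {0..T} \<Longrightarrow> (u t)\<^sup>2 + (v t)\<^sup>2 + (f (r t))\<^sup>2 * (w 0)\<^sup>2 = c\<^sup>2"
  using energy by (simp add: r_def)

lemma rad_\<gamma>: "t \<in> {0..T} \<Longrightarrow> rad (\<gamma> t) = r t"
  by (simp add: \<gamma> rad_def r_def)

lemma r_nonneg: "0 \<le> r t"
  by (simp add: r_def)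

lemma r_square: "(r t)\<^sup>2 = (x t)\<^sup>2 + (y t)\<^sup>2"
  by (simp add: r_def)

lemma derivs:
  assumes "t \<in> {0..T}"
  shows "(x has_real_derivative u t) (at t within {0..T})"
    "(y has_real_derivative v t) (at t within {0..T})"
    "(z has_real_derivative (f (r t))\<^sup>2 * w 0) (at t within {0..T})"
    "(u has_real_derivative - force t * x t) (at t within {0..T})"
    "(v has_real_derivative - force t * y t) (at t within {0..T})"
  using hamilton_solD[OF sol assms] hamilton_sol_w_const[OF sol assms]
  by (simp_all add: r_def force_def mult.assoc)

lemma restrict:
  assumes "0 < \<epsilon>" "\<epsilon> \<le> T"
  shows "normal_curve f \<epsilon> x y z u v w \<gamma> c"
proof
  show "hamilton_sol f \<epsilon> x y z u v w"
    using hamilton_sol_shift[OF sol, of 0 \<epsilon>] assms by simp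
qed (use assms f \<gamma> c energy in auto)

lemma continuous:
  shows "continuous_on {0..T} x" "continuous_on {0..T} y" "continuous_on {0..T} z"
    "continuous_on {0..T} u" "continuous_on {0..T} v" "continuous_on {0..T} r" "continuous_on {0..T} (\<lambda>t. f (r t))"
proof -
  show xy: "continuous_on {0..T} x" "continuous_on {0..T} y" "continuous_on {0..T} z"
    "continuous_on {0..T} u" "continuous_on {0..T} v"
    by (rule DERIV_continuous_on, erule derivs)+
  show r: "continuous_on {0..T} r"
    unfolding r_def by (intro continuous_intros xy)
  show "continuous_on {0..T} (\<lambda>t. f (r t))"
    by (rule continuous_on_compose2[OF classF_continuous[OF f] r]) (auto simp: r_nonneg)
qed

text \<open>The vertical velocity \<open>f\<^sup>2 w\<close> is split as \<open>(f w) * f\<close> to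
  exhibit the third control \<open>f w\<close>.\<close>

lemma has_vector_derivative_\<gamma>:
  assumes t: "t \<in> {0..T}"
  shows "(\<gamma> has_vector_derivative (u t, v t, (f (r t) * w 0) * f (rad (\<gamma> t)))) (at t within {0..T})"
proof -
  have "((\<lambda>t. (x t, y t, z t)) has_vector_derivative (u t, v t, (f (r t))\<^sup>2 * w 0)) (at t within {0..T})"
    using derivs(1-3)[OF t] unfolding has_real_derivative_iff_has_vector_derivative
    by (intro has_vector_derivative_Pair)
  then have "(\<gamma> has_vector_derivative (u t, v t, (f (r t))\<^sup>2 * w 0)) (at t within {0..T})"
    by (rule has_vector_derivative_transform[OF t, rotated]) (simp add: \<gamma>)
  then show ?thesis
    by (simp add: rad_\<gamma>[OF t] power2_eq_square mult_ac)
qed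

lemma admissible_\<gamma>: "admissible f T \<gamma>"
  unfolding admissible_def
proof (intro conjI exI ballI)
  have "abs_cont_on {0..T} (\<lambda>t. (x t, y t, z t))"
    by (intro abs_cont_on_Pair abs_cont_on_C1[OF derivs(1)] abs_cont_on_C1[OF derivs(2)]
        abs_cont_on_C1[OF derivs(3)] continuous_intros continuous)
  then show "abs_cont_on {0..T} \<gamma>"
    by (rule abs_cont_on_dominated[OF _ abs_cont_on_const[of _ "0 :: real"], of _ _ 1]) (auto simp: \<gamma>)
  show "negligible {}" by simp
  show "(\<gamma> has_vector_derivative (u t, v t, (f (r t) * w 0) * f (rad (\<gamma> t)))) (at t within {0..T})"
    if "t \<in> {0..T} - {}" for t
    using has_vector_derivative_\<gamma> that by simp
  have meas: "g measurable_on {0..T}" if "continuous_on {0..T} g" for g :: "real \<Rightarrow> real"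
    using continuous_imp_measurable_on_sets_lebesgue[OF that] by (simp add: measurable_on_iff_borel_measurable)
  show "u measurable_on {0..T}" "v measurable_on {0..T}" "(\<lambda>t. f (r t) * w 0) measurable_on {0..T}"
    by (intro meas continuous_intros continuous)+
  show "(\<lambda>t. (u t)\<^sup>2) integrable_on {0..T}" "(\<lambda>t. (v t)\<^sup>2) integrable_on {0..T}"
    "(\<lambda>t. (f (r t) * w 0)\<^sup>2) integrable_on {0..T}"
    by (intro integrable_continuous_real continuous_intros continuous)+
qed (use T in simp)

lemma speed_\<gamma>: "speed f T \<gamma> t = c" if t: "t \<in> {0..T}"
proof -
  have "vector_derivative \<gamma> (at t within {0..T}) = (u t, v t, (f (r t))\<^sup>2 * w 0)"
    using vector_derivative_within_cbox[of 0 T t \<gamma>] has_vector_derivative_\<gamma>[OF t] T t rad_\<gamma>[OF t]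
    by (simp add: power2_eq_square mult_ac)
  \<comment> \<open>Where \<open>f\<close> vanishes, division by zero makes the vertical term 0, in
    agreement with \<open>f\<^sup>2 w\<^sup>2 = 0\<close>.\<close>
  then have "speed f T \<gamma> t = sqrt ((u t)\<^sup>2 + (v t)\<^sup>2 + (f (r t))\<^sup>2 * (w 0)\<^sup>2)"
    by (cases "f (r t) = 0") (simp_all add: speed_def rad_\<gamma>[OF t] power2_eq_square)
  then show ?thesis using energy_r[OF t] c by simp
qed

lemma len_\<gamma>: "len f T \<gamma> = c * T"
proof -
  have "len f T \<gamma> = integral {0..T} (\<lambda>_. c)"
    unfolding len_def by (rule integral_cong) (rule speed_\<gamma>)
  then show ?thesis using T by simp
qed

lemma const_speed_\<gamma>: "const_speed f T \<gamma>"
  unfolding const_speed_def using speed_\<gamma> by (intro exI[of _ c] exI[of _ "{}"]) auto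

end

section \<open>Short arcs starting off the axis\<close>

text \<open>The left side is the derivative of the function \<Phi> used below: \<open>m\<close> is
  the clock rate, \<open>(a, b, d)\<close> are the controls of the competitor,
  \<open>(h1, h2)\<close> is its planar displacement from the trajectory, \<open>g\<close> is the
  force, and \<open>K\<close> includes the factor \<open>w\<^sup>2\<close>. \<open>F\<close> and
  \<open>F'\<close> are the values of the profile at the trajectory and at the competitor;
  \<open>F'\<close> is no derivative. Three completed squares prove the bound: one from
  \<open>d - m * w * F'\<close> and two from the velocity differences \<alpha> and \<beta>.\<close>

lemma calibration_inequality:
  fixes m w d F F' c u v a b g x y h1 h2 K s :: real
  assumes m: "0 < m" and K: "0 \<le> K" and s: "4 * K * s\<^sup>2 \<le> 1"
    and energy: "u\<^sup>2 + v\<^sup>2 + F\<^sup>2 * w\<^sup>2 = c\<^sup>2"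
    and semi: "w\<^sup>2 * F'\<^sup>2 \<le> w\<^sup>2 * F\<^sup>2 + 2 * g * (x * h1 + y * h2) + K * (h1\<^sup>2 + h2\<^sup>2)"
  shows "w * (d * F' - (F\<^sup>2 * w) * m) + c\<^sup>2 / 2 * m
      + ((- g * x * m) * h1 + (a - u * m) * u) + ((- g * y * m) * h2 + (b - v * m) * v)
      - K * (m * (h1\<^sup>2 + h2\<^sup>2) + (2 * ((a - u * m) * h1) + 2 * ((b - v * m) * h2)) * s)
    \<le> (a\<^sup>2 + b\<^sup>2 + d\<^sup>2) / m / 2" (is "?L \<le> _")
proof -
  define \<alpha> \<beta> where "\<alpha> = a - u * m" and "\<beta> = b - v * m"
  have ab: "a = \<alpha> + u * m" "b = \<beta> + v * m" by (simp_all add: \<alpha>_def \<beta>_def)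
  have 1: "2 * m * (w * d * F') \<le> d\<^sup>2 + m\<^sup>2 * (w\<^sup>2 * F'\<^sup>2)"
    using zero_le_power2[of "d - m * w * F'"] by (simp add: power2_eq_square algebra_simps)
  have 2: "m\<^sup>2 * (w\<^sup>2 * F'\<^sup>2) \<le> m\<^sup>2 * (w\<^sup>2 * F\<^sup>2 + 2 * g * (x * h1 + y * h2) + K * (h1\<^sup>2 + h2\<^sup>2))"
    using semi by (intro mult_left_mono) auto
  \<comment> \<open>After multiplication by \<open>2 * m\<close>, the correction supplies
    \<open>2 m\<^sup>2 K\<close> times the squared displacement. Half of it pays for the
    semiconcavity error in \<open>2\<close>; by \<open>4 K s\<^sup>2 \<le> 1\<close> the other half
    pays for the remainder here.\<close>
  have 3: "- 4 * m * K * s * (h1 * \<alpha> + h2 * \<beta>) \<le> \<alpha>\<^sup>2 + \<beta>\<^sup>2 + (4 * K * s\<^sup>2) * (K * m\<^sup>2 * (h1\<^sup>2 + h2\<^sup>2))"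
    using zero_le_power2[of "\<alpha> + 2 * K * s * m * h1"] zero_le_power2[of "\<beta> + 2 * K * s * m * h2"]
    by (simp add: power2_eq_square algebra_simps)
  have 4: "(4 * K * s\<^sup>2) * (K * m\<^sup>2 * (h1\<^sup>2 + h2\<^sup>2)) \<le> 1 * (K * m\<^sup>2 * (h1\<^sup>2 + h2\<^sup>2))"
    using s K by (intro mult_right_mono) auto
  have "2 * m * ?L = 2 * m * (w * d * F') - 2 * m\<^sup>2 * (w\<^sup>2 * F\<^sup>2) + m\<^sup>2 * (u\<^sup>2 + v\<^sup>2 + F\<^sup>2 * w\<^sup>2)
      - m\<^sup>2 * (2 * g * (x * h1 + y * h2)) + 2 * m * (u * \<alpha> + v * \<beta>)
      - 2 * m\<^sup>2 * (K * (h1\<^sup>2 + h2\<^sup>2)) - 4 * m * K * s * (h1 * \<alpha> + h2 * \<beta>)"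
    unfolding energy ab by (simp add: power2_eq_square algebra_simps)
  also have "\<dots> \<le> d\<^sup>2 + m\<^sup>2 * (u\<^sup>2 + v\<^sup>2) + 2 * m * (u * \<alpha> + v * \<beta>) + \<alpha>\<^sup>2 + \<beta>\<^sup>2"
    using 1 2 3 4 by (simp add: algebra_simps)
  also have "\<dots> = a\<^sup>2 + b\<^sup>2 + d\<^sup>2"
    unfolding ab by (simp add: power2_eq_square algebra_simps)
  finally have "2 * m * ?L \<le> a\<^sup>2 + b\<^sup>2 + d\<^sup>2" .
  then show ?thesis using m by (simp add: field_simps)
qed

lemma classF_continuous_deriv:
  assumes "classF f"
  shows "continuous_on {0<..} (deriv f)"
proof -
  obtain f1 f2 where f1: "\<And>r. r > 0 \<Longrightarrow> (f has_real_derivative f1 r) (at r)"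
    and f2: "\<And>r. r > 0 \<Longrightarrow> (f1 has_real_derivative f2 r) (at r)"
    using assms unfolding classF_def by blast
  have "continuous_on {0<..} f1"
    by (rule DERIV_continuous_on[where D = f2]) (simp add: f2 has_field_derivative_at_within)
  then show ?thesis
    by (rule continuous_on_eq) (use f1 DERIV_imp_deriv in force)
qed

context normal_curve
begin

lemma rad_near:
  assumes "admissible f T' \<gamma>'" "0 < T'" "\<gamma>' 0 = \<gamma> 0" "len f T' \<gamma>' \<le> L" "t \<in> {0..T'}"
  shows "\<bar>rad (\<gamma>' t) - r 0\<bar> \<le> L"
proof -
  have "\<bar>rad (\<gamma>' t) - rad (\<gamma>' 0)\<bar> \<le> len f T' \<gamma>'"
    using rad_lipschitz[of "\<gamma>' t" "\<gamma>' 0"] planar_displacement_le_len[OF f assms(1,2,5)] by linarith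
  then show ?thesis using assms(3,4) rad_\<gamma>[of 0] T by simp
qed

text \<open>The competitor at time \<open>t\<close> is compared with the normal curve at the time \<open>s t\<close> shown by the clock;
  the last term of \<open>\<Phi>\<close> absorbs the second-order error of the potential.\<close>

lemma length_minimizer_off_axis:
  assumes r0: "0 < r 0" and K: "K \<ge> 0"
    and semi: "\<And>p q. \<lbrakk>rad p \<in> {r 0/2..2 * r 0}; rad q \<in> {r 0/2..2 * r 0}\<rbrakk> \<Longrightarrow>
      (f (rad q))\<^sup>2 \<le> (f (rad p))\<^sup>2
        + 2 * (f (rad p) * deriv f (rad p) / rad p)
            * (fst p * (fst q - fst p) + fst (snd p) * (fst (snd q) - fst (snd p)))
        + K * ((fst q - fst p)\<^sup>2 + (fst (snd q) - fst (snd p))\<^sup>2)"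
    and near: "c * T \<le> r 0 / 2" and small: "4 * ((w 0)\<^sup>2 * K) * T\<^sup>2 \<le> 1"
  shows "length_minimizer f T \<gamma>"
proof (rule length_minimizerI[OF admissible_\<gamma>], rule ccontr)
  fix T' \<gamma>'
  assume T': "0 < T'" and adm: "admissible f T' \<gamma>'" and ends: "\<gamma>' 0 = \<gamma> 0" "\<gamma>' T' = \<gamma> T"
    and "\<not> len f T \<gamma> \<le> len f T' \<gamma>'"
  then have less: "len f T' \<gamma>' < c * T" by (simp add: len_\<gamma>)
  obtain N a b d where N: "negligible N"
    and a: "\<And>t. t \<in> {0..T'} - N \<Longrightarrow> ((\<lambda>t. fst (\<gamma>' t)) has_real_derivative a t) (at t within {0..T'})"
    and b: "\<And>t. t \<in> {0..T'} - N \<Longrightarrow> ((\<lambda>t. fst (snd (\<gamma>' t))) has_real_derivative b t) (at t within {0..T'})"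
    and d: "\<And>t. t \<in> {0..T'} - N \<Longrightarrow>
        ((\<lambda>t. snd (snd (\<gamma>' t))) has_real_derivative d t * f (rad (\<gamma>' t))) (at t within {0..T'})"
    and sp: "\<And>t. t \<in> {0..T'} - N \<Longrightarrow> speed f T' \<gamma>' t = sqrt ((a t)\<^sup>2 + (b t)\<^sup>2 + (d t)\<^sup>2)"
    and "\<And>t. rad (\<gamma>' t) = 0 \<Longrightarrow> d t = 0"
    and int: "speed f T' \<gamma>' integrable_on {0..T'}" "(\<lambda>t. (speed f T' \<gamma>' t)\<^sup>2) integrable_on {0..T'}"
    by (rule admissible_velocity[OF f adm T']) (rule that)
  \<comment> \<open>Measured on this clock, the competitor has action below
    \<open>c\<^sup>2 * T / 2\<close>, the action of the trajectory, and both take total time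
    \<open>T\<close>.\<close>
  obtain m where m: "continuous_on {0..T'} m" "\<And>t. t \<in> {0..T'} \<Longrightarrow> 0 < m t"
    "integral {0..T'} m = T" "(\<lambda>t. (speed f T' \<gamma>' t)\<^sup>2 / m t) integrable_on {0..T'}"
    "integral {0..T'} (\<lambda>t. (speed f T' \<gamma>' t)\<^sup>2 / m t) < c\<^sup>2 * T"
    by (rule continuous_clock[OF T' c T int speed_nonneg less[unfolded len_def]]) (rule that)
  define s where "s t = integral {0..t} m" for t
  have s': "(s has_real_derivative m t) (at t within {0..T'})" if "t \<in> {0..T'}" for t
    unfolding s_def[abs_def] by (rule integral_has_real_derivative[OF m(1) that])
  have s_cont: "continuous_on {0..T'} s"
    by (rule DERIV_continuous_on[OF s'])
  have m_int: "m integrable_on {0..t}" if "t \<in> {0..T'}" for t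
    by (rule integrable_continuous_real[OF continuous_on_subset[OF m(1)]]) (use that in auto)
  have s_range: "s t \<in> {0..T}" if t: "t \<in> {0..T'}" for t
  proof -
    have "0 \<le> s t" unfolding s_def
      by (rule integral_nonneg[OF m_int[OF t]]) (use m(2) t in \<open>auto intro: less_imp_le\<close>)
    moreover have "s t \<le> integral {0..T'} m" unfolding s_def
      by (rule integral_subset_le) (use t T' m(2) m_int in \<open>auto intro: less_imp_le\<close>)
    ultimately show ?thesis using m(3) by simp
  qed
  have s0: "s 0 = 0" and sT: "s T' = T" by (simp_all add: s_def m(3))
  have chain: "((\<lambda>t. g (s t)) has_real_derivative D (s t) * m t) (at t within {0..T'})"
    if "\<And>t. t \<in> {0..T} \<Longrightarrow> (g has_real_derivative D t) (at t within {0..T})" "t \<in> {0..T'}" for g D t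
    using DERIV_image_chain[OF has_field_derivative_subset[OF that(1)[OF s_range[OF that(2)]]] s'[OF that(2)]]
      s_range by (auto simp: o_def image_subset_iff)
  have comp: "continuous_on {0..T'} (\<lambda>t. g (s t))" if "continuous_on {0..T} g" for g :: "real \<Rightarrow> real"
    by (rule continuous_on_compose2[OF that s_cont]) (use s_range in auto)
  have ac: "abs_cont_on {0..T'} (\<lambda>t. g (s t))"
    if "\<And>t. t \<in> {0..T} \<Longrightarrow> (g has_real_derivative D t) (at t within {0..T})" "continuous_on {0..T} D" for g D
    by (rule abs_cont_on_C1[OF chain[OF that(1)]]) (auto intro!: continuous_intros comp m(1) that(2))
  \<comment> \<open>The trajectory is treated as its own competitor.\<close>
  have r_near: "r t \<in> {r 0/2..2 * r 0}" if "t \<in> {0..T}" for t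
    using rad_near[OF admissible_\<gamma> T refl _ that, of "c * T"] near r0 rad_\<gamma>[OF that] len_\<gamma>
    by auto
  have rad_near': "rad (\<gamma>' t) \<in> {r 0/2..2 * r 0}" if "t \<in> {0..T'}" for t
    using rad_near[OF adm T' ends(1) less_imp_le[OF less] that] near r0 by auto
  \<comment> \<open>Staying off the axis makes the force continuous, so that \<open>u\<close> and
    \<open>v\<close> composed with the clock are continuously differentiable.\<close>
  have force_cont: "continuous_on {0..T} force"
  proof -
    have r_pos: "r t > 0" if "t \<in> {0..T}" for t using r_near[OF that] r0 by auto
    then have "continuous_on {0..T} (\<lambda>t. deriv f (r t))"
      by (intro continuous_on_compose2[OF classF_continuous_deriv[OF f] continuous(6)]) auto
    then show ?thesis unfolding force_def[abs_def] using r_pos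
      by (intro continuous_intros continuous) fastforce+
  qed
  define X where "X t = fst (\<gamma>' t)" for t
  define Y where "Y t = fst (snd (\<gamma>' t))" for t
  define Z where "Z t = snd (snd (\<gamma>' t))" for t
  define h1 where "h1 t = X t - x (s t)" for t
  define h2 where "h2 t = Y t - y (s t)" for t
  \<comment> \<open>\<open>c\<^sup>2 / 2 * s\<close> is the action of the trajectory up to time
    \<open>s\<close>, and the covector \<open>(u, v, w)\<close> acts on the displacement of the
    competitor: the first-order expansion of the value function.\<close>
  define \<Phi> where "\<Phi> t = w 0 * (Z t - z (s t)) + c\<^sup>2 / 2 * s t + u (s t) * h1 t + v (s t) * h2 t
    - (w 0)\<^sup>2 * K * (s t * (h1 t * h1 t + h2 t * h2 t))" for t
  have ac\<gamma>: "abs_cont_on {0..T'} \<gamma>'" using adm by (simp add: admissible_def)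
  have "abs_cont_on {0..T'} X" "abs_cont_on {0..T'} Y" and acZ: "abs_cont_on {0..T'} Z"
    unfolding X_def[abs_def] Y_def[abs_def] Z_def[abs_def]
    by (intro abs_cont_on_fst abs_cont_on_snd ac\<gamma>)+
  then have ach: "abs_cont_on {0..T'} h1" "abs_cont_on {0..T'} h2"
    unfolding h1_def[abs_def] h2_def[abs_def]
    by (intro abs_cont_on_diff ac[OF derivs(1)] ac[OF derivs(2)] continuous; simp)+
  have "\<Phi> T' - \<Phi> 0 \<le> integral {0..T'} (\<lambda>t. (speed f T' \<gamma>' t)\<^sup>2 / m t / 2)"
  proof (rule abs_cont_le_integral[OF _ _ N])
    show "0 \<le> T'" using T' by simp
    have "abs_cont_on {0..T'} s"
      by (rule abs_cont_on_C1[OF s' m(1)])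
    moreover have "abs_cont_on {0..T'} (\<lambda>t. z (s t))"
      by (rule ac[OF derivs(3)]) (auto intro!: continuous_intros continuous)
    moreover have "abs_cont_on {0..T'} (\<lambda>t. u (s t))"
      by (rule ac[OF derivs(4)]) (auto intro!: continuous_intros continuous force_cont)
    moreover have "abs_cont_on {0..T'} (\<lambda>t. v (s t))"
      by (rule ac[OF derivs(5)]) (auto intro!: continuous_intros continuous force_cont)
    ultimately show "abs_cont_on {0..T'} \<Phi>"
      unfolding \<Phi>_def[abs_def]
      by (intro abs_cont_on_diff abs_cont_on_add abs_cont_on_mult abs_cont_on_const ach acZ)
    show "(\<lambda>t. (speed f T' \<gamma>' t)\<^sup>2 / m t / 2) integrable_on {0..T'}"
      using m(4) by (rule integrable_on_divide)
    fix t assume tN: "t \<in> {0..T'} - N"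
    then have t: "t \<in> {0..T'}" by simp
    have h1': "(h1 has_real_derivative a t - u (s t) * m t) (at t within {0..T'})"
      unfolding h1_def[abs_def] X_def by (rule DERIV_diff[OF a[OF tN] chain[OF derivs(1) t]])
    have h2': "(h2 has_real_derivative b t - v (s t) * m t) (at t within {0..T'})"
      unfolding h2_def[abs_def] Y_def by (rule DERIV_diff[OF b[OF tN] chain[OF derivs(2) t]])
    have sq: "((\<lambda>t. g t * g t) has_real_derivative 2 * (D * g t)) (at t within {0..T'})"
      if "(g has_real_derivative D) (at t within {0..T'})" for g D
      using DERIV_mult[OF that that] by simp
    show "(\<Phi> has_real_derivative
        w 0 * (d t * f (rad (\<gamma>' t)) - ((f (r (s t)))\<^sup>2 * w 0) * m t) + c\<^sup>2 / 2 * m t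
      + ((- force (s t) * x (s t) * m t) * h1 t + (a t - u (s t) * m t) * u (s t))
      + ((- force (s t) * y (s t) * m t) * h2 t + (b t - v (s t) * m t) * v (s t))
      - (w 0)\<^sup>2 * K * (m t * (h1 t * h1 t + h2 t * h2 t)
          + (2 * ((a t - u (s t) * m t) * h1 t) + 2 * ((b t - v (s t) * m t) * h2 t)) * s t)) (at t within {0..T'})"
      unfolding \<Phi>_def[abs_def] Z_def
      by (rule DERIV_diff[OF DERIV_add[OF DERIV_add[OF DERIV_add[OF
              DERIV_cmult[OF DERIV_diff[OF d[OF tN] chain[OF derivs(3) t]]]
              DERIV_cmult[OF s'[OF t]]]
              DERIV_mult[OF chain[OF derivs(4) t] h1']]
              DERIV_mult[OF chain[OF derivs(5) t] h2']]
            DERIV_cmult[OF DERIV_mult[OF s'[OF t] DERIV_add[OF sq[OF h1'] sq[OF h2']]]]])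
    have "(w 0)\<^sup>2 * (f (rad (\<gamma>' t)))\<^sup>2 \<le> (w 0)\<^sup>2 * (f (r (s t)))\<^sup>2
        + 2 * force (s t) * (x (s t) * h1 t + y (s t) * h2 t) + (w 0)\<^sup>2 * K * ((h1 t)\<^sup>2 + (h2 t)\<^sup>2)"
    proof -
      note st = s_range[OF t]
      have "rad (\<gamma> (s t)) \<in> {r 0/2..2 * r 0}" using r_near[OF st] rad_\<gamma>[OF st] by simp
      from semi[OF this rad_near'[OF t]]
      have "(f (rad (\<gamma>' t)))\<^sup>2 \<le> (f (r (s t)))\<^sup>2
        + 2 * (f (r (s t)) * deriv f (r (s t)) / r (s t)) * (x (s t) * h1 t + y (s t) * h2 t)
        + K * ((h1 t)\<^sup>2 + (h2 t)\<^sup>2)"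
        unfolding rad_\<gamma>[OF st] unfolding \<gamma>[OF st] by (simp add: h1_def h2_def X_def Y_def)
      then have "(w 0)\<^sup>2 * (f (rad (\<gamma>' t)))\<^sup>2 \<le> (w 0)\<^sup>2 * ((f (r (s t)))\<^sup>2
        + 2 * (f (r (s t)) * deriv f (r (s t)) / r (s t)) * (x (s t) * h1 t + y (s t) * h2 t)
        + K * ((h1 t)\<^sup>2 + (h2 t)\<^sup>2))"
        by (rule mult_left_mono) simp
      then show ?thesis by (simp add: force_def algebra_simps)
    qed
    moreover have "4 * ((w 0)\<^sup>2 * K) * (s t)\<^sup>2 \<le> 1"
    proof -
      have "(s t)\<^sup>2 \<le> T\<^sup>2" using s_range[OF t] by (intro power_mono) auto
      then have "4 * ((w 0)\<^sup>2 * K) * (s t)\<^sup>2 \<le> 4 * ((w 0)\<^sup>2 * K) * T\<^sup>2"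
        using K by (intro mult_left_mono) auto
      then show ?thesis using small by linarith
    qed
    moreover have "(speed f T' \<gamma>' t)\<^sup>2 = (a t)\<^sup>2 + (b t)\<^sup>2 + (d t)\<^sup>2"
      by (simp add: sp[OF tN])
    ultimately show "w 0 * (d t * f (rad (\<gamma>' t)) - ((f (r (s t)))\<^sup>2 * w 0) * m t) + c\<^sup>2 / 2 * m t
      + ((- force (s t) * x (s t) * m t) * h1 t + (a t - u (s t) * m t) * u (s t))
      + ((- force (s t) * y (s t) * m t) * h2 t + (b t - v (s t) * m t) * v (s t))
      - (w 0)\<^sup>2 * K * (m t * (h1 t * h1 t + h2 t * h2 t)
          + (2 * ((a t - u (s t) * m t) * h1 t) + 2 * ((b t - v (s t) * m t) * h2 t)) * s t)
      \<le> (speed f T' \<gamma>' t)\<^sup>2 / m t / 2"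
      using calibration_inequality[OF m(2)[OF t] _ _ energy_r[OF s_range[OF t]]] K
      by (simp add: power2_eq_square)
  qed
  also have "\<dots> = integral {0..T'} (\<lambda>t. (speed f T' \<gamma>' t)\<^sup>2 / m t) / 2"
    by (rule integral_divide)
  also have "\<dots> < c\<^sup>2 * T / 2" using m(5) by simp
  finally have "\<Phi> T' - \<Phi> 0 < c\<^sup>2 * T / 2" .
  \<comment> \<open>At both ends the displacement vanishes and only the action term remains.\<close>
  moreover have "\<Phi> 0 = 0" "\<Phi> T' = c\<^sup>2 * T / 2"
    using ends \<gamma>[of 0] \<gamma>[of T] T by (simp_all add: \<Phi>_def h1_def h2_def X_def Y_def Z_def s0 sT)
  ultimately show False by simp
qed

end

section \<open>Short arcs starting on the axis\<close>

context normal_curve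
begin

text \<open>The radial momentum at speed \<open>c\<close>. The truncation at 0 keeps it defined and
  continuous beyond a radius where \<open>w\<^sup>2 f\<^sup>2\<close> reaches
  \<open>c\<^sup>2\<close>.\<close>

definition p :: "real \<Rightarrow> real" where "p \<rho> = sqrt (max 0 (c\<^sup>2 - (w 0)\<^sup>2 * (f \<rho>)\<^sup>2))"

text \<open>Off the axis and where \<open>w\<^sup>2 f\<^sup>2 \<le> c\<^sup>2\<close>, the function
  \<open>P(r) + w z\<close> solves the eikonal equation, because
  \<open>p\<^sup>2 + w\<^sup>2 f\<^sup>2 = c\<^sup>2\<close>.\<close>

definition P :: "real \<Rightarrow> real" where "P \<rho> = integral {0..\<rho>} p"

lemma p_bounds: "0 \<le> p \<rho>" "p \<rho> \<le> c"
proof -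
  show "0 \<le> p \<rho>" by (simp add: p_def)
  have "p \<rho> \<le> sqrt (c\<^sup>2)" unfolding p_def by (intro real_sqrt_le_mono) auto
  then show "p \<rho> \<le> c" using c by simp
qed

lemma P_deriv: "\<rho> \<in> {0..R} \<Longrightarrow> (P has_real_derivative p \<rho>) (at \<rho> within {0..R})"
  unfolding P_def[abs_def]
proof (rule integral_has_real_derivative)
  show "continuous_on {0..R} p"
    unfolding p_def[abs_def]
    by (intro continuous_intros continuous_on_subset[OF classF_continuous[OF f]]) auto
qed

lemma P_deriv_at: "0 < \<rho> \<Longrightarrow> (P has_real_derivative p \<rho>) (at \<rho>)"
  using P_deriv[of \<rho> "\<rho> + 1"] at_within_interior[of \<rho> "{0..\<rho>+1}"] by (simp add: interior_atLeastAtMost_real)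

lemma P_lipschitz:
  assumes "0 \<le> \<rho>" "0 \<le> \<rho>'"
  shows "\<bar>P \<rho> - P \<rho>'\<bar> \<le> c * \<bar>\<rho> - \<rho>'\<bar>"
  using field_differentiable_bound[of "{0..max \<rho> \<rho>'}" P p c \<rho> \<rho>'] P_deriv p_bounds assms by simp

text \<open>As \<open>p 0 = c > 0\<close>, the composition of \<open>P\<close> with
  \<open>rad\<close> has a cone point on the axis. The Lipschitz bound still makes it absolutely
  continuous along every competitor.\<close>

lemma P_rad_lipschitz: "\<bar>P (rad q) - P (rad q')\<bar> \<le> c * norm (q - q')"
proof -
  have "\<bar>P (rad q) - P (rad q')\<bar> \<le> c * \<bar>rad q - rad q'\<bar>"
    by (rule P_lipschitz) (simp_all add: rad_nonneg)
  also have "\<dots> \<le> c * norm (q - q')" using c by (intro mult_left_mono rad_lipschitz_norm) simp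
  finally show ?thesis .
qed

text \<open>A curve starting on the axis has zero angular momentum, so it moves radially and gives equality
  in the calibration \<open>p d\<rho> + w dz \<le> c ds\<close>.\<close>

lemma calibrated:
  assumes r0: "r 0 = 0" and out: "\<And>t. t \<in> {0<..T} \<Longrightarrow> 0 < x t * u t + y t * v t"
  shows "P (r T) + w 0 * z T - (P (r 0) + w 0 * z 0) = c\<^sup>2 * T"
proof -
  \<comment> \<open>The force is parallel to \<open>(x, y)\<close>, so angular momentum is
    conserved.\<close>
  have ang: "x t * v t - y t * u t = 0" if "t \<in> {0..T}" for t
  proof -
    have "x t * v t - y t * u t = x 0 * v 0 - y 0 * u 0"
    proof (rule DERIV_zero_imp_const[OF _ that])
      fix t assume t: "t \<in> {0..T}"
      show "((\<lambda>t. x t * v t - y t * u t) has_real_derivative 0) (at t within {0..T})"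
        by (rule DERIV_cong[OF DERIV_diff[OF DERIV_mult[OF derivs(1)[OF t] derivs(5)[OF t]]
                DERIV_mult[OF derivs(2)[OF t] derivs(4)[OF t]]]]) (simp add: algebra_simps)
    qed
    then show ?thesis using r0 by (simp add: r_def)
  qed
  define G where "G t = P (r t) + w 0 * z t" for t
  have G_cont: "continuous_on {0..T} G"
  proof -
    have "continuous_on {0..} P"
      unfolding continuous_on_iff
    proof (intro ballI allI impI)
      fix \<rho> e :: real assume "\<rho> \<in> {0..}" "0 < e"
      then show "\<exists>d>0. \<forall>\<rho>'\<in>{0..}. dist \<rho>' \<rho> < d \<longrightarrow> dist (P \<rho>') (P \<rho>) < e"
        using P_lipschitz c by (intro exI[of _ "e / c"])
          (auto simp: dist_real_def field_simps intro: le_less_trans)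
    qed
    then have "continuous_on {0..T} (\<lambda>t. P (r t))"
      by (rule continuous_on_compose2[OF _ continuous(6)]) (auto simp: r_nonneg)
    then show ?thesis unfolding G_def[abs_def] by (intro continuous_intros continuous)
  qed
  \<comment> \<open>Restricted to interior times because the curve starts at the cone point;
    continuity at the endpoints is enough for the mean value theorem.\<close>
  have G_deriv: "(G has_real_derivative c\<^sup>2) (at t)" if t: "0 < t" "t < T" for t
  proof -
    have tT: "t \<in> {0..T}" using t by simp
    have at: "at t within {0..T} = at t"
      using t by (intro at_within_interior) (simp add: interior_atLeastAtMost_real)
    note D = derivs[OF tT, unfolded at]
    define k where "k = x t * u t + y t * v t"
    have k: "k > 0" using out[of t] t by (simp add: k_def)
    then have "r t \<noteq> 0" by (auto simp: k_def r_def)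
    then have r: "r t > 0" using r_nonneg[of t] by simp
    have "(r has_real_derivative k / r t) (at t)"
      using DERIV_rad[OF D(1,2), of 0 "\<lambda>_. 0"] r by (simp add: rad_def r_def[abs_def] k_def)
    then have 1: "((\<lambda>t. P (r t)) has_real_derivative p (r t) * (k / r t)) (at t)"
      by (rule DERIV_chain2[where f = P and g = r, OF P_deriv_at[OF r]])
    have p2: "p (r t) = sqrt ((u t)\<^sup>2 + (v t)\<^sup>2)"
    proof -
      have "c\<^sup>2 - (w 0)\<^sup>2 * (f (r t))\<^sup>2 = (u t)\<^sup>2 + (v t)\<^sup>2"
        using energy_r[OF tT] by (simp add: algebra_simps)
      then show ?thesis by (simp add: p_def)
    qed
    \<comment> \<open>Lagrange's identity. Without angular momentum \<open>k\<close> is plus or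
      minus \<open>r * p\<close>, and outward motion selects the sign.\<close>
    have "k\<^sup>2 + (x t * v t - y t * u t)\<^sup>2 = (r t)\<^sup>2 * ((u t)\<^sup>2 + (v t)\<^sup>2)"
      unfolding r_square k_def by (simp add: power2_eq_square algebra_simps)
    then have "k\<^sup>2 = (r t * p (r t))\<^sup>2"
      using ang[OF tT] by (simp add: p2 power_mult_distrib)
    then have "k = r t * p (r t)"
      using k r p_bounds(1)[of "r t"] by (simp add: power2_eq_iff_nonneg)
    then have "p (r t) * (k / r t) = (u t)\<^sup>2 + (v t)\<^sup>2"
      using r by (simp add: p2 flip: power2_eq_square)
    then show ?thesis
      unfolding G_def[abs_def] using energy_r[OF tT]
      by (intro DERIV_cong[OF DERIV_add[OF 1 DERIV_cmult[OF D(3)]]]) (simp add: power2_eq_square algebra_simps)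
  qed
  have "\<exists>l \<xi>. 0 < \<xi> \<and> \<xi> < T \<and> (G has_real_derivative l) (at \<xi>) \<and> G T - G 0 = (T - 0) * l"
    by (rule MVT[OF T G_cont]) (use G_deriv in \<open>auto simp: real_differentiable_def\<close>)
  then obtain l \<xi> where "0 < \<xi>" "\<xi> < T" "(G has_real_derivative l) (at \<xi>)" "G T - G 0 = T * l" by auto
  moreover from this have "l = c\<^sup>2" using G_deriv DERIV_unique by blast
  ultimately show ?thesis by (simp add: G_def mult.commute)
qed

text \<open>\<open>P \<circ> rad\<close> is not differentiable on the axis. Up to the last visit \<open>t0\<close> of the competitor to the axis,
  \<open>w dz \<le> c ds\<close> suffices, since \<open>P \<circ> rad\<close> has the same value at both ends.\<close>

lemma length_minimizer_on_axis:
  assumes r0: "r 0 = 0" and out: "\<And>t. t \<in> {0<..T} \<Longrightarrow> 0 < x t * u t + y t * v t"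
    and small: "\<And>\<rho>. \<rho> \<in> {0..c * T} \<Longrightarrow> (w 0)\<^sup>2 * (f \<rho>)\<^sup>2 \<le> c\<^sup>2"
  shows "length_minimizer f T \<gamma>"
proof (rule length_minimizerI[OF admissible_\<gamma>], rule ccontr)
  fix T' \<gamma>'
  assume T': "0 < T'" and adm: "admissible f T' \<gamma>'" and ends: "\<gamma>' 0 = \<gamma> 0" "\<gamma>' T' = \<gamma> T"
    and "\<not> len f T \<gamma> \<le> len f T' \<gamma>'"
  then have less: "len f T' \<gamma>' < c * T" by (simp add: len_\<gamma>)
  obtain N a b d where N: "negligible N"
    and a: "\<And>t. t \<in> {0..T'} - N \<Longrightarrow> ((\<lambda>t. fst (\<gamma>' t)) has_real_derivative a t) (at t within {0..T'})"
    and b: "\<And>t. t \<in> {0..T'} - N \<Longrightarrow> ((\<lambda>t. fst (snd (\<gamma>' t))) has_real_derivative b t) (at t within {0..T'})"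
    and d: "\<And>t. t \<in> {0..T'} - N \<Longrightarrow>
        ((\<lambda>t. snd (snd (\<gamma>' t))) has_real_derivative d t * f (rad (\<gamma>' t))) (at t within {0..T'})"
    and sp: "\<And>t. t \<in> {0..T'} - N \<Longrightarrow> speed f T' \<gamma>' t = sqrt ((a t)\<^sup>2 + (b t)\<^sup>2 + (d t)\<^sup>2)"
    and "\<And>t. rad (\<gamma>' t) = 0 \<Longrightarrow> d t = 0"
    and int: "speed f T' \<gamma>' integrable_on {0..T'}" and "(\<lambda>t. (speed f T' \<gamma>' t)\<^sup>2) integrable_on {0..T'}"
    by (rule admissible_velocity[OF f adm T']) (rule that)
  have ac\<gamma>: "abs_cont_on {0..T'} \<gamma>'" using adm by (simp add: admissible_def)
  have ac: "abs_cont_on {0..T'} (\<lambda>t. w 0 * snd (snd (\<gamma>' t)))" "abs_cont_on {0..T'} (\<lambda>t. P (rad (\<gamma>' t)))"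
    using c by (auto intro!: abs_cont_on_cmult abs_cont_on_snd ac\<gamma>
        abs_cont_on_lipschitz_compose[OF ac\<gamma>, of c] P_rad_lipschitz)
  have wf: "(w 0)\<^sup>2 * (f (rad (\<gamma>' t)))\<^sup>2 \<le> c\<^sup>2" if "t \<in> {0..T'}" for t
  proof -
    have "rad (\<gamma>' t) \<in> {0..c * T}"
      using rad_near[OF adm T' ends(1) less_imp_le[OF less] that] r0 rad_nonneg by auto
    then show ?thesis by (rule small)
  qed
  \<comment> \<open>On the radii within reach the truncation in \<open>p\<close> is
    inactive.\<close>
  have p2: "(p (rad (\<gamma>' t)))\<^sup>2 + (w 0)\<^sup>2 * (f (rad (\<gamma>' t)))\<^sup>2 = c\<^sup>2" if "t \<in> {0..T'}" for t
    using wf[OF that] by (simp add: p_def)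
  \<comment> \<open>The visits to the axis form a compact set containing 0, so there is a last
    one.\<close>
  define A where "A = {t \<in> {0..T'}. rad (\<gamma>' t) = 0}"
  have "continuous_on {0..T'} (\<lambda>t. rad (\<gamma>' t))"
    unfolding rad_def by (intro continuous_intros abs_cont_on_imp_continuous_on[OF ac\<gamma>])
  then have "closed A"
    unfolding A_def using continuous_closed_preimage_constant[of "{0..T'}" "\<lambda>t. rad (\<gamma>' t)" 0] by simp
  then have "compact A"
    using compact_Int_closed[of "{0..T'}" A] by (simp add: A_def Int_absorb1 subset_eq)
  moreover have "0 \<in> A" using ends(1) rad_\<gamma>[of 0] r0 T T' by (simp add: A_def)
  ultimately obtain t0 where t0: "t0 \<in> A" "\<And>t. t \<in> A \<Longrightarrow> t \<le> t0"
    using compact_attains_sup[of A] by auto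
  have t0T: "0 \<le> t0" "t0 \<le> T'" "rad (\<gamma>' t0) = 0" using t0(1) by (auto simp: A_def)
  have rad_pos: "rad (\<gamma>' t) > 0" if "t0 < t" "t \<le> T'" for t
    using t0(2)[of t] that t0T rad_nonneg[of "\<gamma>' t"] by (force simp: A_def)
  have "w 0 * snd (snd (\<gamma>' t0)) - w 0 * snd (snd (\<gamma>' 0)) \<le> integral {0..t0} (\<lambda>t. c * speed f T' \<gamma>' t)"
  proof (rule abs_cont_le_integral[OF _ _ N])
    show "abs_cont_on {0..t0} (\<lambda>t. w 0 * snd (snd (\<gamma>' t)))"
      by (rule abs_cont_on_subset[OF ac(1)]) (use t0T in auto)
    show "(\<lambda>t. c * speed f T' \<gamma>' t) integrable_on {0..t0}"
      using t0T by (intro integrable_on_mult_right integrable_on_subinterval[OF int]) auto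
    fix t assume "t \<in> {0..t0} - N"
    then have tN: "t \<in> {0..T'} - N" using t0T by auto
    show "((\<lambda>t. w 0 * snd (snd (\<gamma>' t))) has_real_derivative w 0 * (d t * f (rad (\<gamma>' t)))) (at t within {0..t0})"
      by (intro DERIV_cmult has_field_derivative_subset[OF d[OF tN]]) (use t0T in auto)
    \<comment> \<open>The planar part of the speed is dropped, and
      \<open>w\<^sup>2 f\<^sup>2 \<le> c\<^sup>2\<close> bounds the vertical part.\<close>
    have "(w 0 * (d t * f (rad (\<gamma>' t))))\<^sup>2 = ((w 0)\<^sup>2 * (f (rad (\<gamma>' t)))\<^sup>2) * (d t)\<^sup>2"
      by (simp add: power_mult_distrib)
    also have "\<dots> \<le> c\<^sup>2 * (speed f T' \<gamma>' t)\<^sup>2"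
      using wf[of t] tN by (intro mult_mono) (auto simp: sp[OF tN])
    finally have "(w 0 * (d t * f (rad (\<gamma>' t))))\<^sup>2 \<le> (c * speed f T' \<gamma>' t)\<^sup>2"
      by (simp add: power_mult_distrib)
    then show "w 0 * (d t * f (rad (\<gamma>' t))) \<le> c * speed f T' \<gamma>' t"
      by (rule power2_le_imp_le) (use c in \<open>simp add: speed_nonneg\<close>)
  qed (use t0T in simp)
  moreover have "(P (rad (\<gamma>' T')) + w 0 * snd (snd (\<gamma>' T'))) - (P (rad (\<gamma>' t0)) + w 0 * snd (snd (\<gamma>' t0)))
      \<le> integral {t0..T'} (\<lambda>t. c * speed f T' \<gamma>' t)"
  proof (rule abs_cont_le_integral)
    \<comment> \<open>\<open>t0\<close> joins the exceptional set because the competitor is at the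
      cone point then.\<close>
    show "negligible (N \<union> {t0})" using N by simp
    show "abs_cont_on {t0..T'} (\<lambda>t. P (rad (\<gamma>' t)) + w 0 * snd (snd (\<gamma>' t)))"
      by (rule abs_cont_on_subset[OF abs_cont_on_add[OF ac(2,1)]]) (use t0T in auto)
    show "(\<lambda>t. c * speed f T' \<gamma>' t) integrable_on {t0..T'}"
      using t0T by (intro integrable_on_mult_right integrable_on_subinterval[OF int]) auto
    fix t assume "t \<in> {t0..T'} - (N \<union> {t0})"
    then have tN: "t \<in> {0..T'} - N" and t: "t0 < t" "t \<le> T'" using t0T by auto
    have pos: "rad (\<gamma>' t) > 0" by (rule rad_pos[OF t])
    define k where "k = fst (\<gamma>' t) * a t + fst (snd (\<gamma>' t)) * b t"
    have sub: "{t0..T'} \<subseteq> {0..T'}" using t0T by auto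
    have "((\<lambda>t. rad (\<gamma>' t)) has_real_derivative k / rad (\<gamma>' t)) (at t within {t0..T'})"
      using DERIV_rad[OF has_field_derivative_subset[OF a[OF tN] sub] has_field_derivative_subset[OF b[OF tN] sub],
          of "snd (snd (\<gamma>' t))" "\<lambda>t. snd (snd (\<gamma>' t))"] pos by (simp add: k_def)
    then have "((\<lambda>t. P (rad (\<gamma>' t))) has_real_derivative p (rad (\<gamma>' t)) * (k / rad (\<gamma>' t))) (at t within {t0..T'})"
      by (rule DERIV_chain2[where f = P and g = "\<lambda>t. rad (\<gamma>' t)", OF P_deriv_at[OF pos]])
    then show "((\<lambda>t. P (rad (\<gamma>' t)) + w 0 * snd (snd (\<gamma>' t))) has_real_derivative
        p (rad (\<gamma>' t)) * (k / rad (\<gamma>' t)) + w 0 * (d t * f (rad (\<gamma>' t)))) (at t within {t0..T'})"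
      by (intro DERIV_add DERIV_cmult has_field_derivative_subset[OF d[OF tN] sub])
    define \<alpha> where "\<alpha> = k / rad (\<gamma>' t)"
    have "k\<^sup>2 \<le> (rad (\<gamma>' t))\<^sup>2 * ((a t)\<^sup>2 + (b t)\<^sup>2)"
      unfolding rad_square k_def using zero_le_power2[of "fst (\<gamma>' t) * b t - fst (snd (\<gamma>' t)) * a t"]
      by (simp add: power2_eq_square algebra_simps)
    then have \<alpha>: "\<alpha>\<^sup>2 \<le> (a t)\<^sup>2 + (b t)\<^sup>2"
      using pos by (simp add: \<alpha>_def power_divide divide_le_eq mult.commute)
    \<comment> \<open>Cauchy-Schwarz for \<open>(p, w f)\<close>, a vector of length
      \<open>c\<close>, and \<open>(\<alpha>, d)\<close>, where \<alpha> is the radial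
      velocity.\<close>
    have "(p (rad (\<gamma>' t)) * \<alpha> + w 0 * (d t * f (rad (\<gamma>' t))))\<^sup>2
        \<le> ((p (rad (\<gamma>' t)))\<^sup>2 + (w 0)\<^sup>2 * (f (rad (\<gamma>' t)))\<^sup>2) * (\<alpha>\<^sup>2 + (d t)\<^sup>2)"
      using zero_le_power2[of "p (rad (\<gamma>' t)) * d t - w 0 * f (rad (\<gamma>' t)) * \<alpha>"]
      by (simp add: power2_eq_square algebra_simps)
    also have "\<dots> \<le> c\<^sup>2 * (speed f T' \<gamma>' t)\<^sup>2"
      using p2[of t] tN \<alpha> by (intro mult_mono) (auto simp: sp[OF tN])
    finally have "(p (rad (\<gamma>' t)) * \<alpha> + w 0 * (d t * f (rad (\<gamma>' t))))\<^sup>2 \<le> (c * speed f T' \<gamma>' t)\<^sup>2"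
      by (simp add: power_mult_distrib)
    then show "p (rad (\<gamma>' t)) * (k / rad (\<gamma>' t)) + w 0 * (d t * f (rad (\<gamma>' t))) \<le> c * speed f T' \<gamma>' t"
      unfolding \<alpha>_def by (rule power2_le_imp_le) (use c in \<open>simp add: speed_nonneg\<close>)
  qed (use t0T in simp)
  moreover have "integral {0..t0} (\<lambda>t. c * speed f T' \<gamma>' t) + integral {t0..T'} (\<lambda>t. c * speed f T' \<gamma>' t)
      = c * len f T' \<gamma>'"
    using Henstock_Kurzweil_Integration.integral_combine[OF t0T(1,2) integrable_on_mult_right[OF int, of c]]
    by (simp add: len_def)
  moreover have "P (rad (\<gamma>' T')) + w 0 * snd (snd (\<gamma>' T')) = P (r T) + w 0 * z T"
    using ends(2) rad_\<gamma>[of T] \<gamma>[of T] T by simp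
  moreover have "P (rad (\<gamma>' t0)) = P (r 0)" "w 0 * snd (snd (\<gamma>' 0)) = w 0 * z 0"
    using ends(1) t0T r0 \<gamma>[of 0] T by simp_all
  ultimately have "c\<^sup>2 * T \<le> c * len f T' \<gamma>'"
    using calibrated[OF r0 out] by simp
  then have "c * (c * T) \<le> c * len f T' \<gamma>'" by (simp add: power2_eq_square)
  then show False using less c by simp
qed

lemma short_time_minimizer:
  obtains \<epsilon> where "0 < \<epsilon>" "\<epsilon> \<le> T" "length_minimizer f \<epsilon> \<gamma>" "const_speed f \<epsilon> \<gamma>"
proof (cases "r 0 = 0")
  case False
  then have r0: "0 < r 0" using r_nonneg[of 0] by simp
  obtain K where K: "K \<ge> 0" and semi: "\<And>p q. \<lbrakk>rad p \<in> {r 0/2..2 * r 0}; rad q \<in> {r 0/2..2 * r 0}\<rbrakk> \<Longrightarrow>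
      (f (rad q))\<^sup>2 \<le> (f (rad p))\<^sup>2
        + 2 * (f (rad p) * deriv f (rad p) / rad p)
            * (fst p * (fst q - fst p) + fst (snd p) * (fst (snd q) - fst (snd p)))
        + K * ((fst q - fst p)\<^sup>2 + (fst (snd q) - fst (snd p))\<^sup>2)"
    by (rule f_square_semiconcave[OF f r0]) (rule that)
  define M where "M = (w 0)\<^sup>2 * K"
  have M: "0 \<le> M" using K by (simp add: M_def)
  \<comment> \<open>The second entry keeps all curves within \<open>r 0 / 2\<close> of the initial
    radius; the third gives \<open>4 * M * \<epsilon>\<^sup>2 \<le> 1\<close> because
    \<open>M\<close> is at most the square of \<open>M + 1\<close>.\<close>
  define \<epsilon> where "\<epsilon> = min T (min (r 0 / (2 * c)) (1 / (2 * (M + 1))))"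
  have \<epsilon>: "0 < \<epsilon>" "\<epsilon> \<le> T" using T r0 c M by (auto simp: \<epsilon>_def)
  interpret n: normal_curve f \<epsilon> x y z u v w \<gamma> c by (rule restrict[OF \<epsilon>])
  have "\<epsilon> \<le> r 0 / (2 * c)" "\<epsilon> \<le> 1 / (2 * (M + 1))" by (simp_all add: \<epsilon>_def)
  then have near: "c * \<epsilon> \<le> r 0 / 2" and e: "2 * (M + 1) * \<epsilon> \<le> 1"
    using c M by (simp_all add: field_simps)
  have "4 * M * \<epsilon>\<^sup>2 \<le> (2 * (M + 1) * \<epsilon>)\<^sup>2"
  proof -
    have "4 * M * \<epsilon>\<^sup>2 \<le> 4 * (M + 1)\<^sup>2 * \<epsilon>\<^sup>2"
      using M by (intro mult_right_mono) (auto simp: power2_eq_square algebra_simps)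
    also have "\<dots> = (2 * (M + 1) * \<epsilon>)\<^sup>2" unfolding power_mult_distrib by simp
    finally show ?thesis .
  qed
  also have "\<dots> \<le> 1\<^sup>2" using e M \<epsilon> by (intro power_mono) auto
  finally have small: "4 * ((w 0)\<^sup>2 * K) * \<epsilon>\<^sup>2 \<le> 1" by (simp add: M_def)
  show thesis
    by (rule that[OF \<epsilon> n.length_minimizer_off_axis[OF r0 K semi near small] n.const_speed_\<gamma>])
next
  case True
  \<comment> \<open>Half the derivative of \<open>r\<^sup>2\<close>. It vanishes at the start with
    derivative \<open>u\<^sup>2 + v\<^sup>2 = c\<^sup>2 > 0\<close>, so the trajectory moves outward
    for a short time.\<close>
  define k where "k t = x t * u t + y t * v t" for t
  have T0: "0 \<in> {0..T}" using T by simp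
  have xy0: "x 0 = 0" "y 0 = 0" using True by (simp_all add: r_def)
  have "(u 0)\<^sup>2 + (v 0)\<^sup>2 = c\<^sup>2"
    using energy_r[OF T0] True classF_zero[OF f] by simp
  then have "(k has_real_derivative c\<^sup>2) (at 0 within {0..T})"
    unfolding k_def[abs_def]
    by (intro DERIV_cong[OF DERIV_add[OF DERIV_mult[OF derivs(1)[OF T0] derivs(4)[OF T0]]
            DERIV_mult[OF derivs(2)[OF T0] derivs(5)[OF T0]]]])
      (simp add: xy0 power2_eq_square)
  from has_real_derivative_pos_inc_right[OF this]
  obtain \<delta>1 where \<delta>1: "\<delta>1 > 0" "\<And>h. 0 < h \<Longrightarrow> h \<in> {0..T} \<Longrightarrow> h < \<delta>1 \<Longrightarrow> k 0 < k h"
    using c by auto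
  have "continuous (at 0 within {0..}) (\<lambda>\<rho>. (w 0)\<^sup>2 * (f \<rho>)\<^sup>2)"
    using classF_continuous[OF f] by (intro continuous_intros) (auto simp: continuous_on_eq_continuous_within)
  then have "\<forall>\<^sub>F \<rho> in at 0 within {0..}. (w 0)\<^sup>2 * (f \<rho>)\<^sup>2 < c\<^sup>2"
    using c classF_zero[OF f] by (intro order_tendstoD(2)[of _ "(w 0)\<^sup>2 * (f 0)\<^sup>2"]) (auto simp: continuous_within)
  then obtain \<delta>2 where \<delta>2: "\<delta>2 > 0" "\<And>\<rho>. 0 < \<rho> \<Longrightarrow> \<rho> < \<delta>2 \<Longrightarrow> (w 0)\<^sup>2 * (f \<rho>)\<^sup>2 < c\<^sup>2"
    unfolding eventually_at by (force simp: dist_real_def)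
  \<comment> \<open>\<delta>1 guarantees outward motion. The last entry keeps the radii up to
    \<open>c * \<epsilon>\<close> where \<open>w\<^sup>2 f\<^sup>2 < c\<^sup>2\<close>; the halves
    make both bounds strict.\<close>
  define \<epsilon> where "\<epsilon> = min T (min (\<delta>1 / 2) (\<delta>2 / (2 * c)))"
  have \<epsilon>: "0 < \<epsilon>" "\<epsilon> \<le> T" using T \<delta>1(1) \<delta>2(1) c by (auto simp: \<epsilon>_def)
  have "\<epsilon> \<le> \<delta>1 / 2" "\<epsilon> \<le> \<delta>2 / (2 * c)" by (simp_all add: \<epsilon>_def)
  then have \<epsilon>1: "\<epsilon> < \<delta>1" and \<epsilon>2: "c * \<epsilon> < \<delta>2"
    using \<delta>1(1) \<delta>2(1) c by (simp_all add: field_simps)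
  interpret n: normal_curve f \<epsilon> x y z u v w \<gamma> c by (rule restrict[OF \<epsilon>])
  have "length_minimizer f \<epsilon> \<gamma>"
  proof (rule n.length_minimizer_on_axis[OF True])
    show "0 < x t * u t + y t * v t" if "t \<in> {0<..\<epsilon>}" for t
      using \<delta>1(2)[of t] that \<epsilon> \<epsilon>1 by (simp add: k_def xy0)
    show "(w 0)\<^sup>2 * (f \<rho>)\<^sup>2 \<le> c\<^sup>2" if "\<rho> \<in> {0..c * \<epsilon>}" for \<rho>
      using \<delta>2(2)[of \<rho>] that \<epsilon>2 classF_zero[OF f] by (cases "\<rho> = 0") auto
  qed
  then show thesis by (rule that[OF \<epsilon> _ n.const_speed_\<gamma>])
qed

end

section \<open>Geodesics and abnormal curves\<close>

lemma normal_trajectory_imp_geodesic: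
  assumes f: "classF f" and T: "0 < T" and traj: "normal_trajectory f T \<gamma>"
    and nonconst: "\<exists>t\<in>{0..T}. \<gamma> t \<noteq> \<gamma> 0"
  shows "geodesic f T \<gamma>"
proof -
  obtain x y z u v w where sol: "hamilton_sol f T x y z u v w"
    and \<gamma>: "\<And>t. t \<in> {0..T} \<Longrightarrow> \<gamma> t = (x t, y t, z t)"
    using traj unfolding normal_trajectory_def by blast
  define E where "E t = (u t)\<^sup>2 + (v t)\<^sup>2 + (f (sqrt ((x t)\<^sup>2 + (y t)\<^sup>2)))\<^sup>2 * (w 0)\<^sup>2" for t
  have E: "E t = E 0" if "t \<in> {0..T}" for t
    unfolding E_def by (rule hamilton_sol_energy[OF f sol that])
  have w: "w t = w 0" if "t \<in> {0..T}" for t by (rule hamilton_sol_w_const[OF sol that])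
  \<comment> \<open>At zero energy every velocity component vanishes and the curve is
    constant.\<close>
  have "E 0 \<noteq> 0"
  proof
    assume "E 0 = 0"
    have zero: "u t = 0" "v t = 0" "(f (sqrt ((x t)\<^sup>2 + (y t)\<^sup>2)))\<^sup>2 * w 0 = 0" if "t \<in> {0..T}" for t
    proof -
      define F where "F = f (sqrt ((x t)\<^sup>2 + (y t)\<^sup>2))"
      have "(u t)\<^sup>2 + (v t)\<^sup>2 + (F * w 0)\<^sup>2 = 0"
        using E[OF that] \<open>E 0 = 0\<close> unfolding E_def F_def by (simp only: power_mult_distrib)
      moreover have "0 \<le> (u t)\<^sup>2" "0 \<le> (v t)\<^sup>2" "0 \<le> (F * w 0)\<^sup>2" by simp_all
      ultimately have "(u t)\<^sup>2 = 0" "(v t)\<^sup>2 = 0" "(F * w 0)\<^sup>2 = 0" by linarith+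
      then show "u t = 0" "v t = 0" "(f (sqrt ((x t)\<^sup>2 + (y t)\<^sup>2)))\<^sup>2 * w 0 = 0"
        unfolding F_def[symmetric] by (simp_all only: power_eq_0_iff) (simp add: power2_eq_square)
    qed
    have cx: "x t = x 0" if "t \<in> {0..T}" for t
      by (rule DERIV_zero_imp_const[OF _ that]) (use hamilton_solD(1)[OF sol] zero(1) in force)
    have cy: "y t = y 0" if "t \<in> {0..T}" for t
      by (rule DERIV_zero_imp_const[OF _ that]) (use hamilton_solD(2)[OF sol] zero(2) in force)
    have cz: "z t = z 0" if "t \<in> {0..T}" for t
    proof (rule DERIV_zero_imp_const[OF _ that])
      fix s assume s: "s \<in> {0..T}"
      show "(z has_real_derivative 0) (at s within {0..T})"
        using hamilton_solD(3)[OF sol s] unfolding w[OF s] zero(3)[OF s] .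
    qed
    have "\<gamma> t = \<gamma> 0" if "t \<in> {0..T}" for t
    proof -
      have "\<gamma> 0 = (x 0, y 0, z 0)" using \<gamma>[of 0] T by simp
      then show ?thesis
        unfolding \<gamma>[OF that] by (simp only: cx[OF that] cy[OF that] cz[OF that])
    qed
    then show False using nonconst by blast
  qed
  moreover have "E 0 \<ge> 0" by (simp add: E_def)
  ultimately have E0: "E 0 > 0" by simp
  show ?thesis
    unfolding geodesic_def
  proof
    fix t assume t: "t \<in> {0..<T}"
    \<comment> \<open>The tail starting at \<open>t\<close> is again a normal curve, with the same
      speed by conservation of energy.\<close>
    interpret normal_curve f "T - t" "\<lambda>s. x (t + s)" "\<lambda>s. y (t + s)" "\<lambda>s. z (t + s)"
        "\<lambda>s. u (t + s)" "\<lambda>s. v (t + s)" "\<lambda>s. w (t + s)" "\<lambda>s. \<gamma> (t + s)" "sqrt (E 0)"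
    proof
      show "hamilton_sol f (T - t) (\<lambda>s. x (t + s)) (\<lambda>s. y (t + s)) (\<lambda>s. z (t + s))
          (\<lambda>s. u (t + s)) (\<lambda>s. v (t + s)) (\<lambda>s. w (t + s))"
        using t by (intro hamilton_sol_shift[OF sol]) auto
      show "(u (t + s))\<^sup>2 + (v (t + s))\<^sup>2 + (f (sqrt ((x (t + s))\<^sup>2 + (y (t + s))\<^sup>2)))\<^sup>2 * (w (t + 0))\<^sup>2
          = (sqrt (E 0))\<^sup>2" if "s \<in> {0..T - t}" for s
      proof -
        have "w (t + 0) = w 0" using w[of t] t by simp
        moreover have "E (t + s) = (sqrt (E 0))\<^sup>2" using E[of "t + s"] t that E0 by simp
        ultimately show ?thesis by (simp only: E_def[of "t + s"])
      qed
    qed (use f t \<gamma> E0 in simp_all)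
    obtain \<epsilon> where "0 < \<epsilon>" "\<epsilon> \<le> T - t" "length_minimizer f \<epsilon> (\<lambda>s. \<gamma> (t + s))"
        "const_speed f \<epsilon> (\<lambda>s. \<gamma> (t + s))"
      by (rule short_time_minimizer)
    then show "\<exists>\<epsilon>>0. t + \<epsilon> \<le> T \<and> length_minimizer f \<epsilon> (\<lambda>s. \<gamma> (t + s)) \<and> const_speed f \<epsilon> (\<lambda>s. \<gamma> (t + s))"
      by (intro exI[of _ \<epsilon>]) auto
  qed
qed

lemma no_abnormal_minimizer:
  assumes f: "classF f" and adm: "admissible f T \<gamma>" and cs: "const_speed f T \<gamma>"
    and nonconst: "\<exists>t\<in>{0..T}. \<gamma> t \<noteq> \<gamma> 0"
    and ac: "abs_cont_on {0..T} p" and nz: "\<exists>t\<in>{0..T}. p t \<noteq> 0"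
    and ham: "\<forall>t\<in>{0..T}. ham f (\<gamma> t) (p t) = 0"
  shows False
proof -
  have T: "0 < T" using nonconst adm by (cases "T = 0") (auto simp: admissible_def)
  obtain N a b d where N: "negligible N"
    and a: "\<And>t. t \<in> {0..T} - N \<Longrightarrow> ((\<lambda>t. fst (\<gamma> t)) has_real_derivative a t) (at t within {0..T})"
    and b: "\<And>t. t \<in> {0..T} - N \<Longrightarrow> ((\<lambda>t. fst (snd (\<gamma> t))) has_real_derivative b t) (at t within {0..T})"
    and d: "\<And>t. t \<in> {0..T} - N \<Longrightarrow>
        ((\<lambda>t. snd (snd (\<gamma> t))) has_real_derivative d t * f (rad (\<gamma> t))) (at t within {0..T})"
    and sp: "\<And>t. t \<in> {0..T} - N \<Longrightarrow> speed f T \<gamma> t = sqrt ((a t)\<^sup>2 + (b t)\<^sup>2 + (d t)\<^sup>2)"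
    and d0: "\<And>t. rad (\<gamma> t) = 0 \<Longrightarrow> d t = 0"
    and "speed f T \<gamma> integrable_on {0..T}" and "(\<lambda>t. (speed f T \<gamma> t)\<^sup>2) integrable_on {0..T}"
    by (rule admissible_velocity[OF f adm T]) (rule that)
  obtain c N' where N': "negligible N'" and c: "\<And>t. t \<in> {0..T} - N' \<Longrightarrow> speed f T \<gamma> t = c"
    using cs unfolding const_speed_def by blast
  have p0: "fst (p t) = 0" "fst (snd (p t)) = 0" "snd (snd (p t)) = 0 \<or> rad (\<gamma> t) = 0" if "t \<in> {0..T}" for t
    using bspec[OF ham that] classF_rad_eq_0_iff[OF f, of "\<gamma> t"]
    by (auto simp: ham_def add_nonneg_eq_0_iff)
  obtain t0 where t0: "t0 \<in> {0..T}" "p t0 \<noteq> 0" using nz by blast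
  have "continuous_on {0..T} p" by (rule abs_cont_on_imp_continuous_on[OF ac])
  then have "continuous (at t0 within {0..T}) p" using t0(1) by (simp add: continuous_on_eq_continuous_within)
  from continuous_within_avoid[OF this t0(2)]
  obtain e where e: "e > 0" "\<And>t. t \<in> {0..T} \<Longrightarrow> dist t0 t < e \<Longrightarrow> p t \<noteq> 0"
    by auto
  \<comment> \<open>The neighbourhood is clipped to the time interval and stays nondegenerate even
    if \<open>t0\<close> is an endpoint.\<close>
  define l h where "l = max 0 (t0 - e)" and "h = min T (t0 + e)"
  have lh: "l < h" using t0(1) e(1) T by (auto simp: l_def h_def)
  have axis: "rad (\<gamma> t) = 0" if "t \<in> {l<..<h}" for t
  proof -
    have "t \<in> {0..T}" "dist t0 t < e" using that by (auto simp: l_def h_def dist_real_def)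
    then have "p t \<noteq> 0" "t \<in> {0..T}" using e(2) by auto
    moreover have "p t = (fst (p t), fst (snd (p t)), snd (snd (p t)))" by simp
    ultimately show ?thesis using p0[of t] by (metis zero_prod_def)
  qed
  \<comment> \<open>Velocity and speed are known only off null sets; an interval of positive length
    contains a time outside both.\<close>
  have "\<not> negligible {l<..<h}"
    using lh negligible_interval(2)[of l h] by simp
  then obtain t1 where t1: "t1 \<in> {l<..<h}" "t1 \<notin> N" "t1 \<notin> N'"
    using negligible_subset[OF negligible_Un[OF N N'], of "{l<..<h}"] by blast
  have t1T: "t1 \<in> {0..T}" and t1i: "0 < t1" "t1 < T" using t1(1) by (auto simp: l_def h_def)
  have at: "at t1 within {0..T} = at t1"
    using t1i by (intro at_within_interior) (simp add: interior_atLeastAtMost_real)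
  have zero: "D = 0" if "(g has_real_derivative D) (at t1 within {0..T})" "\<And>t. t \<in> {l<..<h} \<Longrightarrow> g t = 0"
    for g :: "real \<Rightarrow> real" and D
  proof -
    have "((\<lambda>_. 0) has_real_derivative D) (at t1)"
      by (rule has_field_derivative_transform_within_open[OF that(1)[unfolded at], of "{l<..<h}"])
        (use t1 that(2) in auto)
    then show ?thesis using DERIV_unique DERIV_const by blast
  qed
  \<comment> \<open>Both planar coordinates vanish near \<open>t1\<close>, hence so do their
    derivatives; with \<open>d = 0\<close> on the axis the speed at \<open>t1\<close> is 0.\<close>
  have "a t1 = 0" "b t1 = 0"
    using zero[OF a] zero[OF b] axis t1 t1T by (auto simp: rad_eq_0_iff)
  then have "c = 0"
    using sp[of t1] c[of t1] d0[OF axis[OF t1(1)]] t1 t1T by simp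
  then have vel0: "a t = 0" "b t = 0" "d t = 0" if "t \<in> {0..T} - (N \<union> N')" for t
    using sp[of t] c[of t] that by (auto simp: add_nonneg_eq_0_iff)
  have ac\<gamma>: "abs_cont_on {0..T} \<gamma>" using adm by (simp add: admissible_def)
  have const: "g t = g 0" if t: "t \<in> {0..T}" and g: "abs_cont_on {0..T} g"
    and der: "\<And>s. s \<in> {0..T} - (N \<union> N') \<Longrightarrow> (g has_real_derivative 0) (at s within {0..T})"
    for g :: "real \<Rightarrow> real" and t
  proof -
    have "((\<lambda>_. 0) has_integral g t - g 0) {0..t}"
    proof (rule has_integral_abs_cont)
      show "abs_cont_on {0..t} g" by (rule abs_cont_on_subset[OF g]) (use t in auto)
      show "negligible (N \<union> N')" using N N' by simp
      show "(g has_vector_derivative 0) (at s within {0..t})" if "s \<in> {0..t} - (N \<union> N')" for s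
        using has_field_derivative_subset[OF der, of s "{0..t}"] that t
        by (auto simp: has_real_derivative_iff_has_vector_derivative)
    qed (use t in simp)
    then show ?thesis by simp
  qed
  have "\<gamma> t = \<gamma> 0" if t: "t \<in> {0..T}" for t
  proof -
    have "fst (\<gamma> t) = fst (\<gamma> 0)"
      by (rule const[OF t abs_cont_on_fst[OF ac\<gamma>]]) (use a vel0 in force)
    moreover have "fst (snd (\<gamma> t)) = fst (snd (\<gamma> 0))"
      by (rule const[OF t abs_cont_on_fst[OF abs_cont_on_snd[OF ac\<gamma>]]]) (use b vel0 in force)
    moreover have "snd (snd (\<gamma> t)) = snd (snd (\<gamma> 0))"
      by (rule const[OF t abs_cont_on_snd[OF abs_cont_on_snd[OF ac\<gamma>]]]) (use d vel0 in force)
    ultimately show ?thesis by (simp add: prod_eq_iff)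
  qed
  then show False using nonconst by blast
qed

text \<open>A constant curve on the axis is a constant-speed minimizer with the abnormal lift
  \<open>(0, 0, 1)\<close>; the nonconstancy clause of the first part excludes it.\<close>

theorem theorem2:
  fixes f :: "real \<Rightarrow> real"
  assumes "classF f"
  shows "(\<forall>T \<gamma>. length_minimizer f T \<gamma> \<and> const_speed f T \<gamma> \<and>
            (\<exists>t\<in>{0..T}. \<gamma> t \<noteq> \<gamma> 0) \<longrightarrow>
            \<not> (\<exists>p::real \<Rightarrow> pt. abs_cont_on {0..T} p \<and> (\<exists>t\<in>{0..T}. p t \<noteq> 0) \<and>
                   (\<forall>t\<in>{0..T}. ham f (\<gamma> t) (p t) = 0)))
       \<and> (\<forall>T \<gamma>. 0 < T \<and> normal_trajectory f T \<gamma> \<and> (\<exists>t\<in>{0..T}. \<gamma> t \<noteq> \<gamma> 0) \<longrightarrow>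
            geodesic f T \<gamma>)"
proof (intro conjI allI impI notI; (elim exE conjE)?)
  fix T \<gamma> and p :: "real \<Rightarrow> pt"
  assume "length_minimizer f T \<gamma>" and *: "const_speed f T \<gamma>" "\<exists>t\<in>{0..T}. \<gamma> t \<noteq> \<gamma> 0"
    "abs_cont_on {0..T} p" "\<exists>t\<in>{0..T}. p t \<noteq> 0" "\<forall>t\<in>{0..T}. ham f (\<gamma> t) (p t) = 0"
  then have "admissible f T \<gamma>" by (simp add: length_minimizer_def)
  then show False by (rule no_abnormal_minimizer[OF assms _ *])
next
  fix T \<gamma>
  assume "0 < T" "normal_trajectory f T \<gamma>" "\<exists>t\<in>{0..T}. \<gamma> t \<noteq> \<gamma> 0"
  then show "geodesic f T \<gamma>" by (rule normal_trajectory_imp_geodesic[OF assms])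
qed

end
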